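(* Let $X$ be a non-Lindelöf space which is either locally compact and paracompact, or locally Lindelöf and metrizable. Let $\lambda$ be the ordinal such that $\aleph_\lambda=\ell(X)$, the Lindelöf number of $X$. Then there exists a chain $$C_0(X)\subsetneqq H_0\subsetneqq H_1\subsetneqq\cdots\subsetneqq H_\lambda=C_b(X)$$ of Banach subalgebras $H_\mu$ of $C_b(X)$, indexed by the ordinals $\mu\leq\lambda$ (with $C_0(X)\subsetneqq H_0$, with $H_\mu\subsetneqq H_\kappa$ whenever $\mu<\kappa\leq\lambda$, and with $H_\lambda=C_b(X)$), such that for each $\mu\leq\lambda$, $H_\mu$ is an ideal of $C_b(X)$ and is isometrically isomorphic to $$C_0(Y_\mu)=C_c(Y_\mu)$$ for some locally compact space $Y_\mu$.
   Context: The scalar field is fixed and is either $\mathbb{R}$ or $\mathbb{C}$. Spaces are topological spaces, assumed non-empty. Compact, locally compact and paracompact spaces are Hausdorff; Lindelöf spaces are regular (Hausdorff). A space is locally Lindelöf if each of its points has a neighborhood that is a Lindelöf subspace. $C_b(X)$ is the Banach algebra of continuous bounded scalar-valued functions on $X$ with the supremum norm; $C_0(X)$ is the set of $f\in C_b(X)$ such that $|f|^{-1}([\epsilon,\infty))$ is compact for each $\epsilon>0$; $C_c(X)$ is the set of $f\in C_b(X)$ whose support $\mathrm{cl}_X\{x:f(x)\neq0\}$ is compact. The Lindelöf number is $\ell(X)=\min\{\mathfrak{n}:\text{any open cover of }X\text{ has a subcover of cardinality}\leq\mathfrak{n}\}+\aleph_0$. *)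

theory Defs
  imports "HOL-Analysis.Analysis"
begin

unbundle cardinal_syntax
no_notation elt_set_eq (infix "=o" 50)  (* clashes with ordinal equality *)

section \<open>Spaces\<close>

definition lindelof :: "'a topology \<Rightarrow> bool" where
  "lindelof X \<longleftrightarrow> regular_space X \<and> Hausdorff_space X \<and> Lindelof_space X"

definition locally_lindelof :: "'a topology \<Rightarrow> bool" where
  "locally_lindelof X \<longleftrightarrow>
     (\<forall>x\<in>topspace X. \<exists>U V. openin X U \<and> x \<in> U \<and> U \<subseteq> V \<and> V \<subseteq> topspace X \<and> lindelof (subtopology X V))"

definition locally_compact_Hausdorff :: "'a topology \<Rightarrow> bool" where
  "locally_compact_Hausdorff X \<longleftrightarrow> locally_compact_space X \<and> Hausdorff_space X"

definition paracompact_Hausdorff :: "'a topology \<Rightarrow> bool" where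
  "paracompact_Hausdorff X \<longleftrightarrow> Hausdorff_space X \<and>
     (\<forall>\<U>. (\<forall>U\<in>\<U>. openin X U) \<and> \<Union>\<U> = topspace X \<longrightarrow>
        (\<exists>\<V>. (\<forall>V\<in>\<V>. openin X V) \<and> \<Union>\<V> = topspace X \<and>
             (\<forall>V\<in>\<V>. \<exists>U\<in>\<U>. V \<subseteq> U) \<and> locally_finite_in X \<V>))"


section \<open>The Lindelof number\<close>

text \<open>Cardinals are represented, as in the library, by the well-orders satisfying \<^term>\<open>Card_order\<close>,
  taken up to \<open>=o\<close>.\<close>

definition subcover_bound :: "'a topology \<Rightarrow> 'b rel \<Rightarrow> bool" where
  "subcover_bound X n \<longleftrightarrow>
     (\<forall>\<U>. (\<forall>U\<in>\<U>. openin X U) \<and> \<Union>\<U> = topspace X \<longrightarrow>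
        (\<exists>\<V>\<subseteq>\<U>. \<Union>\<V> = topspace X \<and> |\<V>| \<le>o n))"

text \<open>The minimum is taken over the cardinals that live on the type of points. Nothing is lost, since
  choosing one member of the cover for each point gives the bound \<^term>\<open>|topspace X|\<close>;
  see \<open>min_subcover_bound_le\<close> below.\<close>

definition min_subcover_bound :: "'a topology \<Rightarrow> 'a rel" where
  "min_subcover_bound X = (SOME n. Card_order n \<and> subcover_bound X n \<and>
     (\<forall>m::'a rel. Card_order m \<and> subcover_bound X m \<longrightarrow> n \<le>o m))"

definition lindelof_number :: "'a topology \<Rightarrow> ('a + nat) rel" where
  "lindelof_number X = min_subcover_bound X +c natLeq"

lemma subcover_bound_points: "subcover_bound X |topspace X|"
  unfolding subcover_bound_def
proof (intro allI impI)
  fix \<U> assume *: "(\<forall>U\<in>\<U>. openin X U) \<and> \<Union>\<U> = topspace X"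
  then have "\<forall>x\<in>topspace X. \<exists>U. U \<in> \<U> \<and> x \<in> U" by blast
  then obtain g where g: "\<And>x. x \<in> topspace X \<Longrightarrow> g x \<in> \<U> \<and> x \<in> g x" by metis
  have "|g ` topspace X| \<le>o |topspace X|" by (rule card_of_image)
  moreover have "g ` topspace X \<subseteq> \<U>" using g by blast
  moreover have "\<Union>(g ` topspace X) = topspace X" using g * by blast
  ultimately show "\<exists>\<V>\<subseteq>\<U>. \<Union>\<V> = topspace X \<and> |\<V>| \<le>o |topspace X|" by blast
qed

lemma min_subcover_bound:
  fixes X :: "'a topology"
  shows Card_order_min_subcover_bound: "Card_order (min_subcover_bound X)"
    and subcover_bound_min_subcover_bound: "subcover_bound X (min_subcover_bound X)"
    and min_subcover_bound_le_aux:
      "\<And>m::'a rel. Card_order m \<Longrightarrow> subcover_bound X m \<Longrightarrow> min_subcover_bound X \<le>o m"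
proof -
  let ?R = "{n::'a rel. Card_order n \<and> subcover_bound X n}"
  have "|topspace X| \<in> ?R" using subcover_bound_points card_of_Card_order by blast
  then have "\<exists>n\<in>?R. \<forall>m\<in>?R. n \<le>o m" by (intro exists_minim_Card_order) auto
  then have "\<exists>n::'a rel. Card_order n \<and> subcover_bound X n \<and>
     (\<forall>m::'a rel. Card_order m \<and> subcover_bound X m \<longrightarrow> n \<le>o m)" by blast
  from someI_ex[OF this]
  have *: "Card_order (min_subcover_bound X) \<and> subcover_bound X (min_subcover_bound X) \<and>
     (\<forall>m::'a rel. Card_order m \<and> subcover_bound X m \<longrightarrow> min_subcover_bound X \<le>o m)"
    unfolding min_subcover_bound_def .
  from * show "Card_order (min_subcover_bound X)" by blast
  from * show "subcover_bound X (min_subcover_bound X)" by blast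
  from * show "\<And>m::'a rel. Card_order m \<Longrightarrow> subcover_bound X m \<Longrightarrow> min_subcover_bound X \<le>o m"
    by blast
qed

lemma min_subcover_bound_le:
  fixes X :: "'a topology" and m :: "'b rel"
  assumes "Card_order m" "subcover_bound X m"
  shows "min_subcover_bound X \<le>o m"
proof (rule ccontr)
  let ?n = "min_subcover_bound X"
  have wo: "Well_order m" "Well_order ?n"
    using assms(1) Card_order_min_subcover_bound[of X] by (simp_all add: card_order_on_def)
  assume "\<not> ?n \<le>o m"
  then have "m <o ?n" using not_ordLeq_iff_ordLess[OF wo] by simp
  then obtain p :: "'a rel" where p: "m =o p" "p <o ?n"
    using internalize_ordLess[of m ?n] by auto
  have "Card_order p" using Card_order_ordIso2[OF assms(1) p(1)] .
  moreover have "subcover_bound X p"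
    unfolding subcover_bound_def
  proof (intro allI impI)
    fix \<U> assume "(\<forall>U\<in>\<U>. openin X U) \<and> \<Union>\<U> = topspace X"
    then obtain \<V> where \<V>: "\<V> \<subseteq> \<U>" "\<Union>\<V> = topspace X" "|\<V>| \<le>o m"
      using assms(2) unfolding subcover_bound_def by auto
    have "|\<V>| \<le>o p" by (rule ordLeq_ordIso_trans[OF \<V>(3) p(1)])
    with \<V>(1,2) show "\<exists>\<V>\<subseteq>\<U>. \<Union>\<V> = topspace X \<and> |\<V>| \<le>o p" by blast
  qed
  ultimately have "?n \<le>o p" by (rule min_subcover_bound_le_aux)
  with not_ordLess_ordLeq[OF p(2)] show False by simp
qed


section \<open>Alephs\<close>

text \<open>Ordinals are represented by well-orders taken up to \<open>=o\<close>; the ordinal 0 is the empty relation.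
  The function \<^term>\<open>F\<close> below is the sequence of the alephs indexed by the ordinals less than \<^term>\<open>L\<close>
  (the element \<^term>\<open>i\<close> of the field of \<^term>\<open>L\<close> standing for the order type of its strict predecessors).
  The recursion is uniform: each aleph is the least infinite cardinal above all earlier ones, which
  comprises the cases of zero, successors and limits.\<close>

definition least_infinite_card_above :: "'b rel set \<Rightarrow> 'b rel \<Rightarrow> bool" where
  "least_infinite_card_above C k \<longleftrightarrow>
     Card_order k \<and> cinfinite k \<and> (\<forall>c\<in>C. c <o k) \<and>
     (\<forall>m::'b rel. Card_order m \<and> cinfinite m \<and> (\<forall>c\<in>C. c <o m) \<longrightarrow> k \<le>o m)"

definition is_aleph :: "'i rel \<Rightarrow> 'b rel \<Rightarrow> bool" where
  "is_aleph L k \<longleftrightarrow> Well_order L \<and>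
     (\<exists>F. (\<forall>i\<in>Field L. least_infinite_card_above (F ` underS L i) (F i)) \<and>
          least_infinite_card_above (F ` Field L) k)"

lemma is_aleph_exists:
  fixes k :: "'b rel"
  assumes k: "Card_order k" "cinfinite k"
  shows "\<exists>L::'b rel. is_aleph L k"
proof -
  define F where "F a = Restr k (underS k a)" for a
  define I where "I = {a\<in>Field k. Card_order (F a) \<and> cinfinite (F a)}"
  define L where "L = Restr k I"
  have wk: "Well_order k" using k unfolding card_order_on_def by blast
  then have wo: "wo_rel k" by (simp add: wo_rel_def)
  have wL: "Well_order L" unfolding L_def by (rule Well_order_Restr[OF wk])
  have FL: "Field L = I"
    unfolding L_def by (rule Refl_Field_Restr2) (auto simp: I_def wo_rel.REFL[OF wo])
  have wF: "Well_order (F a)" for a unfolding F_def by (rule Well_order_Restr[OF wk])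
  have Fk: "F a <o k" if "a \<in> Field k" for a
    unfolding F_def using underS_Restr_ordLess[OF wk] that by blast
  have ofil: "wo_rel.ofilter k (underS k a)" for a by (rule wo_rel.underS_ofilter[OF wo])
  have lt: "F a <o F b \<longleftrightarrow> a \<in> underS k b" if "a \<in> Field k" "b \<in> Field k" for a b
  proof -
    have "F a <o F b \<longleftrightarrow> underS k a \<subset> underS k b"
      unfolding F_def using ofilter_subset_ordLess[OF wk ofil ofil] by blast
    also have "\<dots> \<longleftrightarrow> a \<in> underS k b"
    proof
      assume "a \<in> underS k b"
      then show "underS k a \<subset> underS k b"
        using wo_rel.ANTISYM[OF wo] wo_rel.TRANS[OF wo]
        unfolding underS_def antisym_def trans_def by blast
    next
      assume "underS k a \<subset> underS k b"
      then obtain c where c: "c \<in> underS k b" "c \<notin> underS k a" by blast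
      then have "c \<in> Field k" unfolding underS_def Field_def by blast
      with c(2) that(1) have "(a, c) \<in> k"
        using wo_rel.TOTALS[OF wo] wo_rel.REFL[OF wo] unfolding underS_def refl_on_def by blast
      with c(1) show "a \<in> underS k b"
        using wo_rel.ANTISYM[OF wo] wo_rel.TRANS[OF wo]
        unfolding underS_def antisym_def trans_def by blast
    qed
    finally show ?thesis .
  qed
  have usL: "underS L i = underS k i \<inter> I" if "i \<in> I" for i
    using that unfolding L_def underS_def by blast
  have IF: "a \<in> Field k" if "a \<in> I" for a using that by (simp add: I_def)
  have min: "\<exists>a\<in>I. m =o F a" if m: "Card_order m" "cinfinite m" and "m <o k" for m :: "'b rel"
  proof -
    have "Well_order m" using m unfolding card_order_on_def by blast
    then obtain a where a: "a \<in> Field k" "m =o F a"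
      using ordLess_iff_ordIso_Restr[OF wk] \<open>m <o k\<close> unfolding F_def by blast
    then have "a \<in> I" using m Cinfinite_cong[of m "F a"] by (simp add: I_def)
    with a show ?thesis by blast
  qed
  have wm: "Well_order m" if "Card_order m" for m :: "'b rel" using that unfolding card_order_on_def by blast
  have "least_infinite_card_above (F ` underS L i) (F i)" if i: "i \<in> Field L" for i
    unfolding least_infinite_card_above_def
  proof (intro conjI ballI allI impI)
    have iI: "i \<in> I" using i FL by simp
    then show "Card_order (F i)" "cinfinite (F i)" by (auto simp: I_def)
    show "c <o F i" if "c \<in> F ` underS L i" for c
      using that usL[OF iI] lt IF iI by blast
    fix m :: "'b rel"
    assume m: "Card_order m \<and> cinfinite m \<and> (\<forall>c\<in>F ` underS L i. c <o m)"
    show "F i \<le>o m"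
    proof (rule ccontr)
      assume "\<not> F i \<le>o m"
      then have mi: "m <o F i" using wF wm m not_ordLeq_iff_ordLess by blast
      then have "m <o k" using Fk[OF IF[OF iI]] ordLess_transitive by blast
      then obtain a where a: "a \<in> I" "m =o F a" using min m by blast
      then have "F a <o F i" using mi ordIso_symmetric ordIso_ordLess_trans by blast
      then have "a \<in> underS L i" using lt a(1) iI IF usL by blast
      then have "F a <o m" using m by blast
      with a(2) show False using not_ordLess_ordIso ordIso_symmetric by blast
    qed
  qed
  moreover have "least_infinite_card_above (F ` Field L) k"
    unfolding least_infinite_card_above_def
  proof (intro conjI ballI allI impI)
    show "Card_order k" "cinfinite k" by fact+
    show "c <o k" if "c \<in> F ` Field L" for c using that FL IF Fk by blast
    fix m :: "'b rel"
    assume m: "Card_order m \<and> cinfinite m \<and> (\<forall>c\<in>F ` Field L. c <o m)"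
    show "k \<le>o m"
    proof (rule ccontr)
      assume "\<not> k \<le>o m"
      then have "m <o k" using wk wm m not_ordLeq_iff_ordLess by blast
      then obtain a where a: "a \<in> I" "m =o F a" using min m by blast
      then have "F a <o m" using m FL by blast
      with a(2) show False using not_ordLess_ordIso ordIso_symmetric by blast
    qed
  qed
  ultimately show ?thesis unfolding is_aleph_def using wL by blast
qed

corollary lindelof_number_is_aleph:
  fixes X :: "'a topology"
  shows "\<exists>L::('a + nat) rel. is_aleph L (lindelof_number X)"
  by (rule is_aleph_exists)
     (simp_all add: lindelof_number_def Card_order_csum cinfinite_csum natLeq_cinfinite)


section \<open>Algebras of continuous functions\<close>

text \<open>The scalars \<^typ>\<open>'k\<close> are to be instantiated by \<^typ>\<open>real\<close> and \<^typ>\<open>complex\<close>. As in the library's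
  metric space \<^term>\<open>cfunspace X euclidean_metric\<close>, a function on \<^term>\<open>X\<close> is a total function that is
  \<^term>\<open>undefined\<close> outside \<^term>\<open>topspace X\<close>, so the pointwise operations are restricted to
  \<^term>\<open>topspace X\<close>. The distance of that metric space is the supremum distance.\<close>

definition Cb :: "'a topology \<Rightarrow> ('a \<Rightarrow> 'k::real_normed_field) set" where
  "Cb X = mspace (cfunspace X euclidean_metric)"

definition sup_norm :: "'a topology \<Rightarrow> ('a \<Rightarrow> 'k::real_normed_field) \<Rightarrow> real" where
  "sup_norm X f = (SUP x\<in>topspace X. norm (f x))"

definition fun_zero :: "'a topology \<Rightarrow> 'a \<Rightarrow> 'k::real_normed_field" where
  "fun_zero X = (\<lambda>x\<in>topspace X. 0)"

definition fun_add :: "'a topology \<Rightarrow> ('a \<Rightarrow> 'k::real_normed_field) \<Rightarrow> ('a \<Rightarrow> 'k) \<Rightarrow> 'a \<Rightarrow> 'k" where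
  "fun_add X f g = (\<lambda>x\<in>topspace X. f x + g x)"

definition fun_scale :: "'a topology \<Rightarrow> 'k::real_normed_field \<Rightarrow> ('a \<Rightarrow> 'k) \<Rightarrow> 'a \<Rightarrow> 'k" where
  "fun_scale X c f = (\<lambda>x\<in>topspace X. c * f x)"

definition fun_mult :: "'a topology \<Rightarrow> ('a \<Rightarrow> 'k::real_normed_field) \<Rightarrow> ('a \<Rightarrow> 'k) \<Rightarrow> 'a \<Rightarrow> 'k" where
  "fun_mult X f g = (\<lambda>x\<in>topspace X. f x * g x)"

definition C0 :: "'a topology \<Rightarrow> ('a \<Rightarrow> 'k::real_normed_field) set" where
  "C0 X = {f \<in> Cb X. \<forall>\<epsilon>>0. compactin X {x\<in>topspace X. \<epsilon> \<le> norm (f x)}}"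

definition Cc :: "'a topology \<Rightarrow> ('a \<Rightarrow> 'k::real_normed_field) set" where
  "Cc X = {f \<in> Cb X. compactin X (X closure_of {x\<in>topspace X. f x \<noteq> 0})}"

text \<open>A subalgebra is not required to contain the constant function 1.\<close>

definition banach_subalgebra :: "'a topology \<Rightarrow> ('a \<Rightarrow> 'k::real_normed_field) set \<Rightarrow> bool" where
  "banach_subalgebra X H \<longleftrightarrow>
     H \<subseteq> Cb X \<and> fun_zero X \<in> H \<and>
     (\<forall>f\<in>H. \<forall>g\<in>H. fun_add X f g \<in> H) \<and>
     (\<forall>c. \<forall>f\<in>H. fun_scale X c f \<in> H) \<and>
     (\<forall>f\<in>H. \<forall>g\<in>H. fun_mult X f g \<in> H) \<and>
     mcomplete_of (submetric (cfunspace X euclidean_metric) H)"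

definition ideal_of_Cb :: "'a topology \<Rightarrow> ('a \<Rightarrow> 'k::real_normed_field) set \<Rightarrow> bool" where
  "ideal_of_Cb X H \<longleftrightarrow>
     H \<subseteq> Cb X \<and> fun_zero X \<in> H \<and>
     (\<forall>f\<in>H. \<forall>g\<in>H. fun_add X f g \<in> H) \<and>
     (\<forall>c. \<forall>f\<in>H. fun_scale X c f \<in> H) \<and>
     (\<forall>g\<in>Cb X. \<forall>f\<in>H. fun_mult X g f \<in> H)"

definition isometrically_isomorphic ::
  "'a topology \<Rightarrow> ('a \<Rightarrow> 'k::real_normed_field) set \<Rightarrow> 'b topology \<Rightarrow> ('b \<Rightarrow> 'k) set \<Rightarrow> bool" where
  "isometrically_isomorphic X A Y B \<longleftrightarrow>
     (\<exists>T. bij_betw T A B \<and>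
        (\<forall>f\<in>A. \<forall>g\<in>A. T (fun_add X f g) = fun_add Y (T f) (T g)) \<and>
        (\<forall>c. \<forall>f\<in>A. T (fun_scale X c f) = fun_scale Y c (T f)) \<and>
        (\<forall>f\<in>A. \<forall>g\<in>A. T (fun_mult X f g) = fun_mult Y (T f) (T g)) \<and>
        (\<forall>f\<in>A. sup_norm Y (T f) = sup_norm X f))"

end

theory Submission
  imports Defs "HOL-Library.Countable_Set_Type"
begin

text \<open>Under either hypothesis \<open>X\<close> splits into a family \<open>P\<close> of non-empty clopen Lindelof subspaces, and since
  \<open>X\<close> is not Lindelof, \<open>P\<close> is infinite and the Lindelof number of \<open>X\<close> is at most \<open>|P|\<close>. Let
  \<open>H \<mu>\<close> consist of the bounded continuous functions that vanish off the union of at most \<open>aleph \<mu>\<close>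
  members of \<open>P\<close>. A countable union of such sets of members is again one, so \<open>H \<mu>\<close> is a closed ideal;
  indicator functions of unions of members of \<open>P\<close> show that the inclusions are strict. Finally \<open>Y \<mu>\<close> is
  the open subspace of the Stone-Cech compactification of \<open>X\<close> that is the union of the closures of the
  sets carrying the functions of \<open>H \<mu>\<close>; each of these closures is compact and open because the sets
  are clopen in \<open>X\<close>.\<close>

section \<open>Partitions into clopen Lindelof subspaces\<close>

text \<open>The equality \<open>C0 Y = Cc Y\<close> is what asks for carriers closed under countable
  unions: a function in \<open>C0 Y\<close> is governed by countably many compact level sets, and
  one compact set inside \<open>Y\<close> has to contain them all. Clopen carriers serve because
  their indicators extend to the compactification and split it into two open and closed halves. The
  members of \<open>P\<close> are Lindelof in order to compare cardinals: each absorbs only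
  countably many sets of an open cover, so \<open>lindelof_number X\<close> is at most
  \<open>|P|\<close>, and \<open>P\<close> has subfamilies of every size aleph \<mu> with \<mu> <
  \<lambda>. This one-sided estimate suffices since the size restriction is dropped altogether at
  \<mu> = \<lambda>, where \<open>X\<close> itself becomes a carrier. All the spaces
  \<open>Y\<close> must live in one type fixed by that of \<open>X\<close>. The compactification
  arises inside a product indexed by functions, so it is carried over to
  \<open>'a set set\<close>.\<close>

definition clopen_partition :: "'a topology \<Rightarrow> 'a set set \<Rightarrow> bool" where
  "clopen_partition X P \<longleftrightarrow> disjoint P \<and> {} \<notin> P \<and> \<Union>P = topspace X \<and> (\<forall>C\<in>P. openin X C)"

lemma openin_Union_clopen_partition:
  assumes "clopen_partition X P" "J \<subseteq> P"
  shows "openin X (\<Union>J)"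
  using assms unfolding clopen_partition_def by blast

lemma clopen_partition_Diff:
  assumes "clopen_partition X P" "J \<subseteq> P"
  shows "topspace X - \<Union>J = \<Union>(P - J)"
proof -
  have "C = D" if "C \<in> P" "D \<in> P" "x \<in> C" "x \<in> D" for C D x
    using assms(1) that unfolding clopen_partition_def disjoint_def by blast
  then show ?thesis
    using assms unfolding clopen_partition_def by blast
qed

text \<open>The complement of a union of members is the union of the remaining members, so openness
  of all members already makes every such union closed.\<close>

lemma closedin_Union_clopen_partition:
  assumes "clopen_partition X P" "J \<subseteq> P"
  shows "closedin X (\<Union>J)"
proof -
  have "openin X (\<Union>(P - J))"
    by (rule openin_Union_clopen_partition[OF assms(1)]) auto
  moreover have "\<Union>J \<subseteq> topspace X"
    using assms unfolding clopen_partition_def by blast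
  ultimately show ?thesis
    unfolding closedin_def clopen_partition_Diff[OF assms] by blast
qed

lemma clopen_partition_compactin:
  assumes "clopen_partition X P" "compactin X K"
  obtains J where "finite J" "J \<subseteq> P" "K \<subseteq> \<Union>J"
proof -
  have "K \<subseteq> topspace X" using compactin_subset_topspace[OF assms(2)] .
  then have "K \<subseteq> \<Union>P" "\<forall>U\<in>P. openin X U"
    using assms(1) unfolding clopen_partition_def by auto
  then show ?thesis
    using assms(2) that unfolding compactin_def by meson
qed

text \<open>Members are disjoint and non-empty, so a subfamily can be recovered from its union. This
  is how statements about sets of points turn into statements about the number of members.\<close>

lemma partition_subset_of_Union:
  assumes "clopen_partition X P" "J \<subseteq> P" "D \<subseteq> P" "\<Union>J \<subseteq> \<Union>D"
  shows "J \<subseteq> D"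
proof
  fix C assume C: "C \<in> J"
  then obtain x where x: "x \<in> C" using assms(1,2) unfolding clopen_partition_def by (metis all_not_in_conv subsetD)
  then obtain E where "E \<in> D" "x \<in> E" using C assms(4) by blast
  moreover have "C = E"
    using assms(1) C x calculation assms(2,3) unfolding clopen_partition_def disjoint_def by blast
  ultimately show "C \<in> D" by simp
qed

text \<open>The equivalence classes of the relation generated by \<open>R\<close> form the partition: the class of a point is the
  union of its iterated \<open>R\<close>-neighbourhoods, which stay inside Lindelof sets.\<close>

lemma lindelof_clopen_partition:
  fixes X :: "'a topology" and R :: "'a \<Rightarrow> 'a \<Rightarrow> bool"
  assumes sym: "\<And>x y. R x y \<Longrightarrow> R y x"
    and refl: "\<And>x. x \<in> topspace X \<Longrightarrow> R x x"
    and opn: "\<And>x. x \<in> topspace X \<Longrightarrow> openin X {y. R x y}"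
    and lin: "\<And>G. \<lbrakk>G \<subseteq> topspace X; Lindelof_space (subtopology X G)\<rbrakk>
           \<Longrightarrow> \<exists>G'. G' \<subseteq> topspace X \<and> Lindelof_space (subtopology X G') \<and> {y. \<exists>x\<in>G. R x y} \<subseteq> G'"
  shows "\<exists>P. clopen_partition X P \<and> (\<forall>C\<in>P. Lindelof_space (subtopology X C))"
proof -
  define cls where "cls x = {y. R\<^sup>*\<^sup>* x y}" for x
  define P where "P = cls ` topspace X"
  have sym': "R\<^sup>*\<^sup>* y x" if "R\<^sup>*\<^sup>* x y" for x y
    using that by (induction) (auto intro: sym converse_rtranclp_into_rtranclp)
  have cls_eq: "cls x = cls y" if "y \<in> cls x" for x y
    using that sym' unfolding cls_def by (auto intro: rtranclp_trans)
  have self: "x \<in> cls x" for x by (simp add: cls_def)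
  have step: "y \<in> topspace X" if "x \<in> topspace X" "R x y" for x y
    using openin_subset[OF opn[OF that(1)]] that(2) by blast
  have sub: "cls x \<subseteq> topspace X" if "x \<in> topspace X" for x
  proof
    fix y assume "y \<in> cls x"
    then have "R\<^sup>*\<^sup>* x y" by (simp add: cls_def)
    then show "y \<in> topspace X" using that by induction (auto intro: step)
  qed
  have ocls: "openin X (cls x)" if "x \<in> topspace X" for x
  proof -
    have "cls x = (\<Union>y\<in>cls x. {z. R y z})"
    proof
      show "cls x \<subseteq> (\<Union>y\<in>cls x. {z. R y z})" using refl sub[OF that] by blast
      show "(\<Union>y\<in>cls x. {z. R y z}) \<subseteq> cls x"
        unfolding cls_def by (auto intro: rtranclp.rtrancl_into_rtrancl)
    qed
    moreover have "openin X (\<Union>y\<in>cls x. {z. R y z})" using opn sub[OF that] by blast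
    ultimately show ?thesis by simp
  qed
  have part: "clopen_partition X P"
    unfolding clopen_partition_def
  proof (intro conjI)
    show "disjoint P" unfolding disjoint_def P_def using cls_eq by blast
    show "{} \<notin> P" unfolding P_def using self by blast
    show "\<Union>P = topspace X" unfolding P_def using self sub by blast
    show "\<forall>C\<in>P. openin X C" unfolding P_def using ocls by blast
  qed
  have "Lindelof_space (subtopology X (cls x))" if x: "x \<in> topspace X" for x
  proof -
    obtain N where N: "\<And>G. \<lbrakk>G \<subseteq> topspace X; Lindelof_space (subtopology X G)\<rbrakk>
           \<Longrightarrow> N G \<subseteq> topspace X \<and> Lindelof_space (subtopology X (N G)) \<and> {y. \<exists>x\<in>G. R x y} \<subseteq> N G"
      using lin by metis
    define S where "S n = (N ^^ n) {x}" for n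
    have S: "S n \<subseteq> topspace X \<and> Lindelof_space (subtopology X (S n))" for n
    proof (induction n)
      case 0
      then show ?case
        using x by (auto simp: S_def intro!: countable_imp_Lindelof_space)
    next
      case (Suc n)
      then show ?case using N[of "S n"] by (simp add: S_def)
    qed
    have "y \<in> \<Union>(range S)" if "R\<^sup>*\<^sup>* x y" for y
      using that
    proof induction
      case base
      have "x \<in> S 0" by (simp add: S_def)
      then show ?case by blast
    next
      case (step y z)
      then obtain n where "y \<in> S n" by blast
      then have "z \<in> S (Suc n)" using N[of "S n"] S[of n] step(2) by (auto simp: S_def)
      then show ?case by blast
    qed
    then have cU: "cls x \<subseteq> \<Union>(range S)" unfolding cls_def by blast
    \<comment> \<open>The Lindelof property passes to closed subsets only; the class is closed
      because the other classes are open.\<close>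
    have "closedin X (cls x)"
      using closedin_Union_clopen_partition[OF part, of "{cls x}"] x by (simp add: P_def)
    then have "closedin (subtopology X (\<Union>(range S))) (cls x)"
      using cU by (simp add: closedin_subset_topspace)
    moreover have "Lindelof_space (subtopology X (\<Union>(range S)))"
      using S by (intro Lindelof_space_Union) auto
    ultimately have "Lindelof_space (subtopology (subtopology X (\<Union>(range S))) (cls x))"
      by (rule Lindelof_space_closedin_subtopology[rotated])
    then show ?thesis using cU by (simp add: subtopology_subtopology Int_absorb1)
  qed
  then show ?thesis using part unfolding P_def by blast
qed

text \<open>Two points are related if they share a member of a locally finite open cover whose
  members lie in compact sets. A Lindelof set is covered by countably many open sets that each meet
  finitely many members, so it meets countably many members, and the corresponding compact sets
  together form a Lindelof set containing all its neighbours.\<close>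

lemma paracompact_clopen_partition:
  assumes "locally_compact_space X" "paracompact_Hausdorff X"
  shows "\<exists>P. clopen_partition X P \<and> (\<forall>C\<in>P. Lindelof_space (subtopology X C))"
proof -
  let ?\<U> = "{U. openin X U \<and> (\<exists>K. compactin X K \<and> U \<subseteq> K)}"
  have "\<Union>?\<U> = topspace X"
  proof
    show "\<Union>?\<U> \<subseteq> topspace X" using openin_subset by blast
    show "topspace X \<subseteq> \<Union>?\<U>"
      using assms(1) unfolding locally_compact_space_def by blast
  qed
  then obtain \<V> where V: "\<And>V. V \<in> \<V> \<Longrightarrow> openin X V" "\<Union>\<V> = topspace X"
      "\<And>V. V \<in> \<V> \<Longrightarrow> \<exists>U\<in>?\<U>. V \<subseteq> U" "locally_finite_in X \<V>"
    using assms(2)[unfolded paracompact_Hausdorff_def, THEN conjunct2, THEN spec, of ?\<U>]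
    by (smt (verit) mem_Collect_eq)
  have "\<exists>K. compactin X K \<and> V \<subseteq> K" if "V \<in> \<V>" for V using V(3)[OF that] by blast
  then obtain K where K: "\<And>V. V \<in> \<V> \<Longrightarrow> compactin X (K V) \<and> V \<subseteq> K V" by metis
  define R where "R x y \<longleftrightarrow> (\<exists>V\<in>\<V>. x \<in> V \<and> y \<in> V)" for x y
  show ?thesis
  proof (rule lindelof_clopen_partition[of R])
    show "R x y \<Longrightarrow> R y x" for x y unfolding R_def by blast
    show "R x x" if "x \<in> topspace X" for x using that V(2) unfolding R_def by blast
    show "openin X {y. R x y}" for x
    proof -
      have "{y. R x y} = \<Union>{V\<in>\<V>. x \<in> V}" unfolding R_def by blast
      then show ?thesis using V(1) by auto
    qed
    fix G assume G: "G \<subseteq> topspace X" "Lindelof_space (subtopology X G)"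
    define meets where "meets W = {V\<in>\<V>. V \<inter> W \<noteq> {}}" for W
    let ?\<W> = "{W. openin X W \<and> finite (meets W)}"
    have "G \<subseteq> \<Union>?\<W>"
      using V(4) G(1) unfolding locally_finite_in_def meets_def by blast
    then obtain \<C> where C: "countable \<C>" "\<C> \<subseteq> ?\<W>" "G \<subseteq> \<Union>\<C>"
      using G unfolding Lindelof_space_subtopology_subset[OF G(1)] by (auto dest!: spec[of _ ?\<W>])
    have "countable (\<Union>(meets ` \<C>))" using C(1,2) by (intro countable_UN) (auto intro: countable_finite)
    have "meets G \<subseteq> \<Union>(meets ` \<C>)" using C(3) unfolding meets_def by blast
    then have cG: "countable (meets G)" using \<open>countable (\<Union>(meets ` \<C>))\<close> countable_subset by blast
    show "\<exists>G'. G' \<subseteq> topspace X \<and> Lindelof_space (subtopology X G') \<and> {y. \<exists>x\<in>G. R x y} \<subseteq> G'"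
    proof (intro exI conjI)
      show "\<Union>(K ` meets G) \<subseteq> topspace X"
        using K compactin_subset_topspace unfolding meets_def by blast
      show "Lindelof_space (subtopology X (\<Union>(K ` meets G)))"
      proof (rule Lindelof_space_Union)
        show "countable (K ` meets G)" using cG by simp
        fix C assume "C \<in> K ` meets G"
        then have "compactin X C" using K unfolding meets_def by blast
        then show "Lindelof_space (subtopology X C)"
          by (simp add: compact_imp_Lindelof_space compact_space_subtopology)
      qed
      show "{y. \<exists>x\<in>G. R x y} \<subseteq> \<Union>(K ` meets G)"
        using K unfolding R_def meets_def by blast
    qed
  qed
qed

text \<open>A point is related to its neighbours within a quarter of the radius up to which balls lie in Lindelof
  sets; this radius is a 1-Lipschitz function of the centre.\<close>

lemma metrizable_clopen_partition:
  assumes "locally_lindelof X" "metrizable_space X"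
  shows "\<exists>P. clopen_partition X P \<and> (\<forall>C\<in>P. Lindelof_space (subtopology X C))"
proof -
  obtain M d where Md: "Metric_space M d" and X: "X = Metric_space.mtopology M d"
    using assms(2) unfolding metrizable_space_def by blast
  interpret Metric_space M d by (rule Md)
  have top: "topspace X = M" by (simp add: X)
  define good where "good x \<rho> \<longleftrightarrow> (\<exists>G\<subseteq>M. Lindelof_space (subtopology X G) \<and> mball x \<rho> \<subseteq> G)" for x \<rho>
  \<comment> \<open>The cap 1 keeps the supremum finite when balls of every radius lie in Lindelof
    sets.\<close>
  define S where "S x = {\<rho>. 0 < \<rho> \<and> \<rho> \<le> 1 \<and> good x \<rho>}" for x
  define r where "r x = Sup (S x)" for x
  have bdd: "bdd_above (S x)" for x unfolding bdd_above_def S_def by blast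
  have ne: "\<exists>\<rho>. \<rho> \<in> S x" if x: "x \<in> M" for x
  proof -
    obtain U V where UV: "openin X U" "x \<in> U" "U \<subseteq> V" "V \<subseteq> M" "lindelof (subtopology X V)"
      using assms(1) x unfolding locally_lindelof_def top by metis
    then obtain e where e: "e > 0" "mball x e \<subseteq> U" unfolding X openin_mtopology by blast
    have "mball x (min e 1) \<subseteq> mball x e" by (rule mball_subset_concentric) simp
    then have "good x (min e 1)"
      unfolding good_def using UV e(2) unfolding lindelof_def by (meson order_trans)
    then have "min e 1 \<in> S x" using e(1) unfolding S_def by auto
    then show ?thesis ..
  qed
  have le: "\<rho> \<le> r x" if "\<rho> \<in> S x" for \<rho> x using cSup_upper[OF that bdd] by (simp add: r_def)
  have pos: "0 < r x" if "x \<in> M" for x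
    using ne[OF that] le[of _ x] unfolding S_def by force
  have ex: "\<exists>\<rho>\<in>S x. \<delta> < \<rho>" if "x \<in> M" "\<delta> < r x" for x \<delta>
    using that ne[OF that(1)] less_cSup_iff[OF _ bdd, of x \<delta>] unfolding r_def by blast
  have good: "good x \<delta>" if x\<delta>: "x \<in> M" "\<delta> < r x" for x \<delta>
  proof -
    obtain \<rho> where "\<rho> \<in> S x" "\<delta> < \<rho>" using ex[OF x\<delta>] by blast
    moreover have "mball x \<delta> \<subseteq> mball x \<rho>" using calculation(2) by (intro mball_subset_concentric) simp
    ultimately show ?thesis unfolding S_def good_def by blast
  qed
  have lip: "r x \<le> r y + d x y" if xy: "x \<in> M" "y \<in> M" for x y
  proof (rule ccontr)
    assume "\<not> ?thesis"
    then have "r y + d x y < r x" by simp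
    then obtain \<rho> where \<rho>: "\<rho> \<in> S x" "r y + d x y < \<rho>" using ex xy by blast
    \<comment> \<open>Moving the centre from \<open>x\<close> to \<open>y\<close> costs at most
      \<open>d x y\<close> of an admissible radius; what remains is admissible at \<open>y\<close>
      and exceeds \<open>r y\<close>, a contradiction.\<close>
    have "mball y (\<rho> - d x y) \<subseteq> mball x \<rho>"
      using that by (intro mball_subset) (auto simp: commute)
    then have "good y (\<rho> - d x y)" using \<rho>(1) unfolding S_def good_def by blast
    moreover have "0 < \<rho> - d x y" "\<rho> - d x y \<le> 1"
      using \<rho> pos[OF xy(2)] nonneg[of x y] unfolding S_def mem_Collect_eq by linarith+
    ultimately have "\<rho> - d x y \<in> S y" unfolding S_def by simp
    from le[OF this] \<rho>(2) show False by simp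
  qed
  \<comment> \<open>Bounding the distance by both radii makes the relation symmetric.\<close>
  define R where "R x y \<longleftrightarrow> x \<in> M \<and> y \<in> M \<and> 4 * d x y < r x \<and> 4 * d x y < r y" for x y
  show ?thesis
  proof (rule lindelof_clopen_partition[of R])
    show "R x y \<Longrightarrow> R y x" for x y unfolding R_def by (simp add: commute)
    show "R x x" if "x \<in> topspace X" for x using that pos unfolding R_def top by simp
    show "openin X {y. R x y}" for x
      unfolding X openin_mtopology
    proof (intro conjI allI impI)
      show "{y. R x y} \<subseteq> M" unfolding R_def by blast
      fix y assume "y \<in> {y. R x y}"
      then have y: "x \<in> M" "y \<in> M" "4 * d x y < r x" "4 * d x y < r y" unfolding R_def by auto
      \<comment> \<open>Replacing \<open>y\<close> by a point within \<open>e\<close> raises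
        \<open>4 * d x y\<close> by at most \<open>4 * e\<close> and lowers the radius at
        \<open>y\<close> by at most \<open>e\<close>, hence the divisor 5.\<close>
      define e where "e = (min (r x) (r y) - 4 * d x y) / 5"
      have "e > 0" using y by (simp add: e_def)
      moreover have "4 * d x y + 5 * e = min (r x) (r y)"
        by (simp add: e_def diff_divide_distrib)
      ultimately have e: "e > 0" "4 * d x y + 5 * e \<le> r x" "4 * d x y + 5 * e \<le> r y" by auto
      have "R x z" if "z \<in> mball y e" for z
      proof -
        have z: "z \<in> M" "d y z < e" using that by auto
        have "d x z \<le> d x y + d y z" using y z by (intro triangle) auto
        moreover have "r y \<le> r z + d y z" using lip y z by blast
        ultimately show ?thesis using y z e unfolding R_def by auto
      qed
      then show "\<exists>e>0. mball y e \<subseteq> {y. R x y}" using e(1) by blast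
    qed
    fix G assume G: "G \<subseteq> topspace X" "Lindelof_space (subtopology X G)"
    let ?B = "\<lambda>t. mball t (r t / 4)"
    have "t \<in> ?B t" if "t \<in> G" for t
    proof -
      have "t \<in> M" using that G(1) top by blast
      then show ?thesis using pos by simp
    qed
    then have "G \<subseteq> \<Union>(?B ` G)" by blast
    moreover have "\<forall>U\<in>?B ` G. openin X U" unfolding X by auto
    ultimately obtain \<C> where C: "countable \<C> \<and> \<C> \<subseteq> ?B ` G" "G \<subseteq> \<Union>\<C>"
      using G(2)[unfolded Lindelof_space_subtopology_subset[OF G(1)], THEN spec, of "?B ` G"] by blast
    obtain D where D: "countable D" "D \<subseteq> G" "G \<subseteq> \<Union>(?B ` D)"
      using C(1)[unfolded countable_subset_image] C(2) by auto
    \<comment> \<open>A neighbour \<open>y\<close> of a point \<open>s\<close> in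
      \<open>?B t\<close> satisfies \<open>d s y < r s / 4\<close> and
      \<open>r s < 5/4 * r t\<close>, so \<open>d t y\<close> is below (1/4 + 5/16)
      \<open>r t\<close> = 9/16 \<open>r t\<close>. The factor 3/4 is above 9/16 and still below 1,
      where \<open>good\<close> is available.\<close>
    have "\<exists>N\<subseteq>M. Lindelof_space (subtopology X N) \<and> mball t (3/4 * r t) \<subseteq> N" if "t \<in> D" for t
    proof -
      have "t \<in> M" using that D(2) G(1) top by auto
      then have "good t (3/4 * r t)" using good pos by simp
      then show ?thesis unfolding good_def .
    qed
    then obtain N where N: "\<And>t. t \<in> D \<Longrightarrow>
        N t \<subseteq> M \<and> Lindelof_space (subtopology X (N t)) \<and> mball t (3/4 * r t) \<subseteq> N t"
      by metis
    show "\<exists>G'. G' \<subseteq> topspace X \<and> Lindelof_space (subtopology X G') \<and> {y. \<exists>x\<in>G. R x y} \<subseteq> G'"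
    proof (intro exI conjI)
      show "\<Union>(N ` D) \<subseteq> topspace X" using N unfolding top by blast
      show "Lindelof_space (subtopology X (\<Union>(N ` D)))"
        using N D(1) by (intro Lindelof_space_Union) auto
      show "{y. \<exists>x\<in>G. R x y} \<subseteq> \<Union>(N ` D)"
      proof clarify
        fix y s assume s: "s \<in> G" "R s y"
        then obtain t where t: "t \<in> D" "s \<in> ?B t" using D(3) by blast
        have sM: "s \<in> M" "y \<in> M" "t \<in> M" using s t unfolding R_def by auto
        have "d t y \<le> d t s + d s y" using sM by (intro triangle) auto
        moreover have "r s \<le> r t + d s t" using lip sM by blast
        moreover have "d s t = d t s" "d t s < r t / 4" using t sM commute by auto
        ultimately have "d t y < 3/4 * r t" using s(2) pos[OF sM(3)] unfolding R_def by linarith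
        then have "y \<in> mball t (3/4 * r t)" using sM by simp
        then show "y \<in> \<Union>(N ` D)" using N t(1) by blast
      qed
    qed
  qed
qed

text \<open>A finite union of Lindelof subspaces is Lindelof, so \<open>P\<close> is infinite.
  Choosing countably many sets of an open cover for each member then gives a subcover of size at
  most \<open>|P|\<close> times aleph 0, which is \<open>|P|\<close>.\<close>

lemma lindelof_number_le_partition:
  assumes P: "clopen_partition X P" "\<And>C. C \<in> P \<Longrightarrow> Lindelof_space (subtopology X C)"
    and "\<not> Lindelof_space X"
  shows "infinite P" "lindelof_number X \<le>o |P|"
proof -
  have UP: "\<Union>P = topspace X" using P(1) unfolding clopen_partition_def by blast
  show inf: "infinite P"
  proof
    assume "finite P"
    then have "Lindelof_space (subtopology X (\<Union>P))"
      using P(2) by (intro Lindelof_space_Union) (auto intro: countable_finite)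
    then show False using assms(3) UP by simp
  qed
  then have natP: "natLeq \<le>o |P|" using infinite_iff_natLeq_ordLeq by blast
  have "subcover_bound X |P|"
    unfolding subcover_bound_def
  proof (intro allI impI)
    fix \<U> assume U: "(\<forall>U\<in>\<U>. openin X U) \<and> \<Union>\<U> = topspace X"
    have "\<exists>\<V>. countable \<V> \<and> \<V> \<subseteq> \<U> \<and> C \<subseteq> \<Union>\<V>" if "C \<in> P" for C
    proof -
      have C: "C \<subseteq> topspace X" using that UP by blast
      with U have "(\<forall>U\<in>\<U>. openin X U) \<and> C \<subseteq> \<Union>\<U>" by simp
      then show ?thesis
        using P(2)[OF that] unfolding Lindelof_space_subtopology_subset[OF C] by simp
    qed
    then obtain V where V: "\<And>C. C \<in> P \<Longrightarrow> countable (V C) \<and> V C \<subseteq> \<U> \<and> C \<subseteq> \<Union>(V C)" by metis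
    have "|V C| \<le>o |P|" if "C \<in> P" for C
      using V[OF that] natP countable_card_le_natLeq ordLeq_transitive by blast
    then have "|\<Union>(V ` P)| \<le>o |P|"
      using inf by (blast intro: card_of_UNION_ordLeq_infinite[OF _ ordIso_imp_ordLeq[OF card_of_refl]])
    moreover have "\<Union>(V ` P) \<subseteq> \<U>" using V by blast
    moreover have "\<Union>(\<Union>(V ` P)) = topspace X"
    proof
      show "\<Union>(\<Union>(V ` P)) \<subseteq> topspace X" using V U by blast
      show "topspace X \<subseteq> \<Union>(\<Union>(V ` P))"
      proof
        fix x assume "x \<in> topspace X"
        then obtain C where C: "C \<in> P" "x \<in> C" using UP by blast
        then obtain W where "W \<in> V C" "x \<in> W" using V[OF C(1)] by blast
        with C(1) show "x \<in> \<Union>(\<Union>(V ` P))" by blast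
      qed
    qed
    ultimately show "\<exists>\<V>\<subseteq>\<U>. \<Union>\<V> = topspace X \<and> |\<V>| \<le>o |P|"
      by (intro exI[of _ "\<Union>(V ` P)"] conjI)
  qed
  then have "min_subcover_bound X \<le>o |P|" by (intro min_subcover_bound_le card_of_Card_order)
  then show "lindelof_number X \<le>o |P|"
    unfolding lindelof_number_def using natP inf
    by (intro csum_cinfinite_bound)
      (simp_all add: cinfinite_def Field_card_of card_of_card_order_on natLeq_Card_order Card_order_min_subcover_bound)
qed


section \<open>Bounded continuous functions and the Stone-Cech compactification\<close>

lemma Cb_iff:
  fixes f :: "'a \<Rightarrow> 'k::real_normed_field"
  shows "f \<in> Cb X \<longleftrightarrow> f \<in> extensional (topspace X) \<and> bounded (f ` topspace X) \<and> continuous_map X euclidean f"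
  by (auto simp: Cb_def)

lemma Cb_bound:
  fixes f :: "'a \<Rightarrow> 'k::real_normed_field"
  assumes "f \<in> Cb X" "x \<in> topspace X"
  shows "norm (f x) \<le> sup_norm X f"
proof -
  have "bdd_above ((\<lambda>x. norm (f x)) ` topspace X)"
    using assms(1) unfolding Cb_iff bounded_iff bdd_above_def by blast
  then show ?thesis unfolding sup_norm_def using assms(2) by (rule cSUP_upper[rotated])
qed

lemma Cb_restrictI:
  fixes g :: "'a \<Rightarrow> 'k::real_normed_field"
  assumes "continuous_map X euclidean g" "\<And>x. x \<in> topspace X \<Longrightarrow> norm (g x) \<le> B"
  shows "(\<lambda>x\<in>topspace X. g x) \<in> Cb X"
proof -
  have "continuous_map X euclidean (\<lambda>x\<in>topspace X. g x)"
    by (rule continuous_map_eq[OF assms(1)]) simp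
  moreover have "bounded ((\<lambda>x\<in>topspace X. g x) ` topspace X)"
    using assms(2) by (auto intro!: boundedI)
  ultimately show ?thesis unfolding Cb_iff by simp
qed

lemma Cb_continuous: "f \<in> Cb X \<Longrightarrow> continuous_map X euclidean f"
  and Cb_extensional: "f \<in> Cb X \<Longrightarrow> f \<in> extensional (topspace X)"
  by (simp_all add: Cb_iff)

lemma fun_zero_Cb: "(fun_zero X :: 'a \<Rightarrow> 'k::real_normed_field) \<in> Cb X"
  unfolding fun_zero_def by (rule Cb_restrictI[of _ _ 0]) auto

lemma fun_add_Cb:
  fixes f g :: "'a \<Rightarrow> 'k::real_normed_field"
  assumes "f \<in> Cb X" "g \<in> Cb X"
  shows "fun_add X f g \<in> Cb X"
  unfolding fun_add_def
proof (rule Cb_restrictI)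
  show "continuous_map X euclidean (\<lambda>x. f x + g x)"
    using assms by (intro continuous_map_add Cb_continuous)
  show "norm (f x + g x) \<le> sup_norm X f + sup_norm X g" if "x \<in> topspace X" for x
    using assms that by (intro norm_triangle_mono Cb_bound)
qed

lemma continuous_map_mult:
  fixes f g :: "'a \<Rightarrow> 'k::real_normed_algebra"
  assumes "continuous_map X euclidean f" "continuous_map X euclidean g"
  shows "continuous_map X euclidean (\<lambda>x. f x * g x)"
  using assms unfolding continuous_map_atin limitin_canonical_iff by (blast intro: tendsto_mult)

lemma fun_mult_Cb:
  fixes f g :: "'a \<Rightarrow> 'k::real_normed_field"
  assumes "f \<in> Cb X" "g \<in> Cb X"
  shows "fun_mult X f g \<in> Cb X"
  unfolding fun_mult_def
proof (rule Cb_restrictI)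
  show "continuous_map X euclidean (\<lambda>x. f x * g x)"
    using assms by (intro continuous_map_mult Cb_continuous)
  show "norm (f x * g x) \<le> sup_norm X f * sup_norm X g" if "x \<in> topspace X" for x
    using assms that unfolding norm_mult
    by (intro mult_mono Cb_bound) (auto intro: order_trans[OF norm_ge_zero Cb_bound])
qed

lemma fun_scale_Cb:
  fixes f :: "'a \<Rightarrow> 'k::real_normed_field"
  assumes "f \<in> Cb X"
  shows "fun_scale X c f \<in> Cb X"
  unfolding fun_scale_def
proof (rule Cb_restrictI)
  show "continuous_map X euclidean (\<lambda>x. c * f x)"
    by (intro continuous_map_mult Cb_continuous[OF assms]) simp
  show "norm (c * f x) \<le> norm c * sup_norm X f" if "x \<in> topspace X" for x
    using assms that unfolding norm_mult by (intro mult_left_mono Cb_bound) auto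
qed

definition clopen_indicator :: "'a topology \<Rightarrow> 'a set \<Rightarrow> 'a \<Rightarrow> 'k::real_normed_field" where
  "clopen_indicator X A = (\<lambda>x\<in>topspace X. if x \<in> A then 1 else 0)"

lemma continuous_map_on_clopen:
  assumes "openin X A" "closedin X A" "continuous_map X Z f" "continuous_map X Z g"
  shows "continuous_map X Z (\<lambda>x. if x \<in> A then f x else g x)"
proof (rule continuous_map_cases)
  have "X frontier_of A = {}"
    using assms(1,2) clopenin_eq_frontier_of by metis
  then show "f x = g x" if "x \<in> X frontier_of {x. x \<in> A}" for x using that by simp
  show "continuous_map (subtopology X (X closure_of {x. x \<in> A})) Z f"
    "continuous_map (subtopology X (X closure_of {x. x \<notin> A})) Z g"
    using assms(3,4) continuous_map_from_subtopology by blast+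
qed

lemma clopen_indicator_Cb:
  assumes "openin X A" "closedin X A"
  shows "(clopen_indicator X A :: 'a \<Rightarrow> 'k::real_normed_field) \<in> Cb X"
  unfolding clopen_indicator_def
  by (rule Cb_restrictI[of _ _ 1]) (auto intro!: continuous_map_on_clopen[OF assms])

section \<open>Compactifications with the extension property, and their transfer to a prescribed
  type\<close>

lemma homeomorphic_map_transfer:
  assumes "inj_on h (topspace Z)"
  shows "\<exists>Z'. homeomorphic_map Z Z' h"
proof -
  let ?g = "inv_into (topspace Z) h"
  let ?Z = "pullback_topology (h ` topspace Z) ?g Z"
  have gh: "?g (h x) = x" if "x \<in> topspace Z" for x using assms that by simp
  have top: "topspace ?Z = h ` topspace Z"
    unfolding topspace_pullback_topology using gh by auto
  have "continuous_map Z ?Z h"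
  proof (rule continuous_map_pullback')
    show "continuous_map Z Z (?g \<circ> h)"
      by (rule continuous_map_eq[of _ _ id]) (auto simp: gh)
  qed auto
  moreover have "continuous_map ?Z Z ?g"
    using continuous_map_pullback[of Z Z id "h ` topspace Z" ?g] by simp
  ultimately have "homeomorphic_maps Z ?Z h ?g"
    unfolding homeomorphic_maps_def top using gh by auto
  then show ?thesis by (metis homeomorphic_maps_map)
qed

text \<open>The map \<open>e\<close> is only asked to be continuous with dense image, since an
  arbitrary \<open>X\<close> need not embed in a compact Hausdorff space. The extension property is
  the substance; the type argument records the scalars, which the other arguments do not
  determine.\<close>

definition stone_cech :: "'a topology \<Rightarrow> 'b topology \<Rightarrow> ('a \<Rightarrow> 'b) \<Rightarrow> 'k::real_normed_field itself \<Rightarrow> bool" where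
  "stone_cech X B e _ \<longleftrightarrow>
     compact_space B \<and> Hausdorff_space B \<and> continuous_map X B e \<and>
     B closure_of (e ` topspace X) = topspace B \<and>
     (\<forall>f::'a \<Rightarrow> 'k. f \<in> Cb X \<longrightarrow>
        (\<exists>g. continuous_map B euclidean g \<and> (\<forall>x\<in>topspace X. g (e x) = f x)))"

text \<open>This is the evaluation map into the product of the closed balls in which the functions
  take their values. The balls are compact by Heine-Borel, the product by Tychonoff, and a function
  extends by its own coordinate projection.\<close>

lemma stone_cech_product:
  fixes X :: "'a topology"
  shows "\<exists>(B :: (('a \<Rightarrow> 'k) \<Rightarrow> 'k) topology) e. stone_cech X B e TYPE('k::{real_normed_field,heine_borel})"
proof -
  define Z where "Z = product_topology (\<lambda>f. top_of_set (cball (0::'k) (sup_norm X f))) (Cb X :: ('a \<Rightarrow> 'k) set)"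
  define e where "e x = (\<lambda>f\<in>(Cb X :: ('a \<Rightarrow> 'k) set). f x)" for x
  define B where "B = subtopology Z (Z closure_of (e ` topspace X))"
  have cZ: "compact_space Z"
    unfolding Z_def compact_space_product_topology by (simp add: compact_space_subtopology)
  have hZ: "Hausdorff_space Z"
    unfolding Z_def Hausdorff_space_product_topology by (simp add: Hausdorff_space_subtopology)
  have eZ: "continuous_map X Z e"
    unfolding Z_def continuous_map_componentwise
  proof (intro conjI ballI)
    show "e ` topspace X \<subseteq> extensional (Cb X)" by (auto simp: e_def)
    fix f :: "'a \<Rightarrow> 'k" assume f: "f \<in> Cb X"
    then show "continuous_map X (top_of_set (cball (0::'k) (sup_norm X f))) (\<lambda>x. e x f)"
      unfolding continuous_map_in_subtopology
      by (auto simp: e_def Cb_continuous Cb_bound)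
  qed
  have sub: "e ` topspace X \<subseteq> topspace Z" using eZ continuous_map_image_subset_topspace by blast
  have topB: "topspace B = Z closure_of (e ` topspace X)"
    unfolding B_def topspace_subtopology using closure_of_subset_topspace[of Z] by (intro Int_absorb1)
  have "stone_cech X B e TYPE('k)"
    unfolding stone_cech_def
  proof (intro conjI allI impI)
    show "compact_space B"
      unfolding B_def using cZ by (simp add: closedin_compact_space compact_space_subtopology)
    show "Hausdorff_space B"
      unfolding B_def using hZ by (rule Hausdorff_space_subtopology)
    show "continuous_map X B e"
      unfolding B_def continuous_map_in_subtopology
      using eZ closure_of_subset[OF sub] by auto
    show "B closure_of (e ` topspace X) = topspace B"
      using closure_of_subset[OF sub] unfolding topB
      unfolding B_def by (simp add: closure_of_subtopology Int_absorb1)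
    fix f :: "'a \<Rightarrow> 'k" assume f: "f \<in> Cb X"
    have "continuous_map Z (top_of_set (cball (0::'k) (sup_norm X f))) (\<lambda>p. p f)"
      unfolding Z_def using f by (rule continuous_map_product_projection)
    then have "continuous_map B euclidean (\<lambda>p. p f)"
      unfolding B_def by (simp add: continuous_map_in_subtopology continuous_map_from_subtopology)
    moreover have "e x f = f x" for x using f by (simp add: e_def)
    ultimately show "\<exists>g. continuous_map B euclidean g \<and> (\<forall>x\<in>topspace X. g (e x) = f x)" by blast
  qed
  then show ?thesis by (intro exI)
qed

text \<open>A point of a Hausdorff space with a dense image of \<open>X\<close> is determined by the subsets of \<open>X\<close> whose images
  accumulate at it, so the points can be taken to be families of subsets of \<open>X\<close>.\<close>

lemma stone_cech_exists:
  fixes X :: "'a topology"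
  shows "\<exists>(B :: 'a set set topology) e. stone_cech X B e TYPE('k::{real_normed_field,heine_borel})"
proof -
  obtain B :: "(('a \<Rightarrow> 'k) \<Rightarrow> 'k) topology" and e where sc: "stone_cech X B e TYPE('k)"
    using stone_cech_product by blast
  note sc' = sc[unfolded stone_cech_def]
  have e: "e ` topspace X \<subseteq> topspace B"
    using sc' continuous_map_image_subset_topspace by blast
  define h where "h p = {A. A \<subseteq> topspace X \<and> p \<in> B closure_of (e ` A)}" for p
  have "inj_on h (topspace B)"
  proof (rule inj_onI, rule ccontr)
    fix p q assume pq: "p \<in> topspace B" "q \<in> topspace B" "h p = h q" "p \<noteq> q"
    then obtain U V where UV: "openin B U" "openin B V" "p \<in> U" "q \<in> V" "disjnt U V"
      using sc' unfolding Hausdorff_space_def by metis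
    \<comment> \<open>By density the part of the image inside \<open>U\<close> accumulates at
      \<open>p\<close>; it cannot accumulate at \<open>q\<close>, whose neighbourhood
      \<open>V\<close> misses \<open>U\<close>. So \<open>A\<close> belongs to \<open>h p\<close>
      and not to \<open>h q\<close>.\<close>
    define A where "A = {x \<in> topspace X. e x \<in> U}"
    have "p \<in> B closure_of (e ` A)"
      unfolding in_closure_of
    proof (intro conjI allI impI)
      fix T assume T: "p \<in> T \<and> openin B T"
      then have "openin B (T \<inter> U)" "p \<in> T \<inter> U" using UV by auto
      moreover have "p \<in> B closure_of (e ` topspace X)" using sc' pq(1) by simp
      ultimately obtain y where "y \<in> e ` topspace X" "y \<in> T \<inter> U" unfolding in_closure_of by blast
      then show "\<exists>y. y \<in> e ` A \<and> y \<in> T" unfolding A_def by blast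
    qed (use pq in simp)
    then have "A \<in> h q" using pq(3) unfolding h_def A_def by blast
    then have "q \<in> B closure_of (e ` A)" unfolding h_def by blast
    then obtain y where "y \<in> e ` A" "y \<in> V" using UV unfolding in_closure_of by blast
    then show False using UV(5) unfolding A_def disjnt_def by blast
  qed
  then obtain B' where B': "homeomorphic_map B B' h" using homeomorphic_map_transfer by blast
  then obtain g where g: "homeomorphic_maps B B' h g" using homeomorphic_map_maps by blast
  have "B homeomorphic_space B'" using B' homeomorphic_map_imp_homeomorphic_space by blast
  have "stone_cech X B' (h \<circ> e) TYPE('k)"
    unfolding stone_cech_def
  proof (intro conjI allI impI)
    show "compact_space B'"
      using sc' homeomorphic_compact_space \<open>B homeomorphic_space B'\<close> by blast
    show "Hausdorff_space B'"
      using sc' homeomorphic_Hausdorff_space \<open>B homeomorphic_space B'\<close> by blast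
    show "continuous_map X B' (h \<circ> e)"
      using sc' g unfolding homeomorphic_maps_def by (blast intro: continuous_map_compose)
    show "B' closure_of ((h \<circ> e) ` topspace X) = topspace B'"
      using homeomorphic_map_closure_of[OF B' e] sc' homeomorphic_imp_surjective_map[OF B']
      by (simp add: image_comp)
    fix f :: "'a \<Rightarrow> 'k" assume "f \<in> Cb X"
    then obtain k where k: "continuous_map B euclidean k" "\<forall>x\<in>topspace X. k (e x) = f x"
      using sc' by blast
    have "continuous_map B' euclidean (k \<circ> g)"
      using k(1) g unfolding homeomorphic_maps_def by (blast intro: continuous_map_compose)
    moreover have "(k \<circ> g) ((h \<circ> e) x) = f x" if x: "x \<in> topspace X" for x
    proof -
      have "e x \<in> topspace B" using e x by blast
      then have "g (h (e x)) = e x" using g unfolding homeomorphic_maps_def by simp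
      then show ?thesis using k(2) x by simp
    qed
    ultimately show "\<exists>g. continuous_map B' euclidean g \<and> (\<forall>x\<in>topspace X. g ((h \<circ> e) x) = f x)"
      by (intro exI[of _ "k \<circ> g"]) simp
  qed
  then show ?thesis by (intro exI)
qed


section \<open>Ideals of functions supported in clopen sets\<close>

definition clopen_sigma_cover :: "'a topology \<Rightarrow> 'a set set \<Rightarrow> bool" where
  "clopen_sigma_cover X \<V> \<longleftrightarrow>
     (\<forall>A\<in>\<V>. openin X A \<and> closedin X A) \<and> (\<forall>\<A>. countable \<A> \<and> \<A> \<subseteq> \<V> \<longrightarrow> \<Union>\<A> \<in> \<V>) \<and>
     \<Union>\<V> = topspace X"

definition supported_in :: "'a topology \<Rightarrow> 'a set set \<Rightarrow> ('a \<Rightarrow> 'k::real_normed_field) set" where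
  "supported_in X \<V> = {f \<in> Cb X. \<exists>A\<in>\<V>. \<forall>x\<in>topspace X - A. f x = 0}"

lemma supported_in_Cb: "supported_in X \<V> \<subseteq> Cb X"
  by (auto simp: supported_in_def)

lemma supported_inI:
  assumes "f \<in> Cb X" "A \<in> \<V>" "\<And>x. \<lbrakk>x \<in> topspace X; x \<notin> A\<rbrakk> \<Longrightarrow> f x = 0"
  shows "f \<in> supported_in X \<V>"
  using assms unfolding supported_in_def by blast

lemma supported_inE:
  assumes "f \<in> supported_in X \<V>"
  obtains A where "A \<in> \<V>" "\<And>x. \<lbrakk>x \<in> topspace X; x \<notin> A\<rbrakk> \<Longrightarrow> f x = 0"
  using assms unfolding supported_in_def by blast

lemma clopen_sigma_cover_Un:
  assumes "clopen_sigma_cover X \<V>" "A \<in> \<V>" "B \<in> \<V>"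
  shows "A \<union> B \<in> \<V>"
proof -
  have "\<Union>{A, B} \<in> \<V>"
    using assms unfolding clopen_sigma_cover_def by (metis countable_empty countable_insert empty_subsetI insert_subset)
  then show ?thesis by simp
qed

lemma clopen_sigma_cover_UN:
  fixes A :: "nat \<Rightarrow> 'a set"
  assumes "clopen_sigma_cover X \<V>" "\<And>n. A n \<in> \<V>"
  shows "(\<Union>n. A n) \<in> \<V>"
proof -
  have "countable (range A)" "range A \<subseteq> \<V>" using assms(2) by auto
  then show ?thesis using assms(1) unfolding clopen_sigma_cover_def by blast
qed

lemma supported_in_ideal:
  assumes V: "clopen_sigma_cover X \<V>"
  shows "ideal_of_Cb X (supported_in X \<V> :: ('a \<Rightarrow> 'k::real_normed_field) set)"
  unfolding ideal_of_Cb_def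
proof (intro conjI ballI allI)
  show "(supported_in X \<V> :: ('a \<Rightarrow> 'k) set) \<subseteq> Cb X" by (rule supported_in_Cb)
  have "\<Union>{} \<in> \<V>" using V unfolding clopen_sigma_cover_def by (metis countable_empty empty_subsetI)
  then show "(fun_zero X :: 'a \<Rightarrow> 'k) \<in> supported_in X \<V>"
    by (rule supported_inI[OF fun_zero_Cb]) (simp add: fun_zero_def)
next
  fix f g :: "'a \<Rightarrow> 'k" assume fg: "f \<in> supported_in X \<V>" "g \<in> supported_in X \<V>"
  obtain A where A: "A \<in> \<V>" "\<And>x. \<lbrakk>x \<in> topspace X; x \<notin> A\<rbrakk> \<Longrightarrow> f x = 0" using supported_inE fg(1) by metis
  obtain B where B: "B \<in> \<V>" "\<And>x. \<lbrakk>x \<in> topspace X; x \<notin> B\<rbrakk> \<Longrightarrow> g x = 0" using supported_inE fg(2) by metis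
  show "fun_add X f g \<in> supported_in X \<V>"
  proof (rule supported_inI)
    show "fun_add X f g \<in> Cb X" using fg supported_in_Cb by (intro fun_add_Cb) auto
    show "A \<union> B \<in> \<V>" using clopen_sigma_cover_Un[OF V A(1) B(1)] .
  qed (use A B in \<open>simp add: fun_add_def\<close>)
next
  fix c :: 'k and f :: "'a \<Rightarrow> 'k" assume f: "f \<in> supported_in X \<V>"
  obtain A where A: "A \<in> \<V>" "\<And>x. \<lbrakk>x \<in> topspace X; x \<notin> A\<rbrakk> \<Longrightarrow> f x = 0" using supported_inE f by metis
  show "fun_scale X c f \<in> supported_in X \<V>"
  proof (rule supported_inI[OF _ A(1)])
    show "fun_scale X c f \<in> Cb X" using f supported_in_Cb by (intro fun_scale_Cb) auto
  qed (use A in \<open>simp add: fun_scale_def\<close>)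
next
  fix f g :: "'a \<Rightarrow> 'k" assume fg: "g \<in> Cb X" "f \<in> supported_in X \<V>"
  obtain A where A: "A \<in> \<V>" "\<And>x. \<lbrakk>x \<in> topspace X; x \<notin> A\<rbrakk> \<Longrightarrow> f x = 0" using supported_inE fg(2) by metis
  show "fun_mult X g f \<in> supported_in X \<V>"
  proof (rule supported_inI[OF _ A(1)])
    show "fun_mult X g f \<in> Cb X" using fg supported_in_Cb by (intro fun_mult_Cb) auto
  qed (use A in \<open>simp add: fun_mult_def\<close>)
qed

text \<open>If \<open>A n\<close> carries the n-th function of a convergent sequence, the limit
  vanishes off the union of all \<open>A n\<close>, again a carrier. So the ideal is sequentially
  closed in the complete space of bounded continuous functions.\<close>

lemma mcomplete_supported_in:
  assumes V: "clopen_sigma_cover X \<V>"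
  shows "mcomplete_of (submetric (cfunspace X euclidean_metric)
           (supported_in X \<V> :: ('a \<Rightarrow> 'k::{real_normed_field,complete_space}) set))"
proof -
  let ?m = "cfunspace X (euclidean_metric :: 'k metric)"
  let ?H = "supported_in X \<V> :: ('a \<Rightarrow> 'k) set"
  have sub: "?H \<subseteq> mspace ?m" using supported_in_Cb unfolding Cb_def .
  interpret S: Submetric "mspace ?m" "mdist ?m" ?H
    by (intro Submetric.intro Metric_space_mspace_mdist Submetric_axioms.intro sub)
  have "mcomplete_of ?m"
    using Met_TC.mcomplete_cfunspace[where 'a='k] complete_UNIV
    unfolding mcomplete_iff_complete Met_TC.Self_def euclidean_metric_def by blast
  then have "S.mcomplete" by (simp add: mcomplete_of_def)
  moreover have "l \<in> ?H" if "range \<sigma> \<subseteq> ?H \<and> limitin S.mtopology \<sigma> l sequentially" for \<sigma> l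
  proof -
    have \<sigma>: "\<sigma> n \<in> ?H" for n using that by blast
    have lim: "l \<in> mspace ?m" "\<And>\<epsilon>. \<epsilon> > 0 \<Longrightarrow> \<exists>N. \<forall>n\<ge>N. \<sigma> n \<in> mspace ?m \<and> mdist ?m (\<sigma> n) l < \<epsilon>"
      using that unfolding S.limit_metric_sequentially by auto
    have "\<exists>A\<in>\<V>. \<forall>x\<in>topspace X - A. \<sigma> n x = 0" for n using \<sigma>[of n] unfolding supported_in_def by blast
    then obtain A where A: "\<And>n. A n \<in> \<V>" "\<And>n x. x \<in> topspace X - A n \<Longrightarrow> \<sigma> n x = 0" by metis
    have "l x = 0" if x: "x \<in> topspace X" "x \<notin> (\<Union>n. A n)" for x
    proof -
      have "norm (l x) \<le> 0 + \<epsilon>" if \<epsilon>: "\<epsilon> > 0" for \<epsilon>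
      proof -
        obtain n where "\<sigma> n \<in> mspace ?m" "mdist ?m (\<sigma> n) l < \<epsilon>" using lim(2)[OF \<epsilon>] by blast
        then have "mdist euclidean_metric (\<sigma> n x) (l x) \<le> \<epsilon>"
          using mdist_cfunspace_imp_mdist_le lim(1) x(1) less_imp_le by metis
        moreover have "\<sigma> n x = 0" using A(2) x by blast
        ultimately show ?thesis by simp
      qed
      then have "norm (l x) \<le> 0" by (rule field_le_epsilon)
      then show ?thesis by simp
    qed
    then show ?thesis
      using lim(1) clopen_sigma_cover_UN[OF V A(1)] unfolding Cb_def[symmetric] by (intro supported_inI)
  qed
  ultimately have "S.sub.mcomplete" by (intro S.sequentially_closedin_mcomplete_imp_mcomplete)
  then show ?thesis
    using sub by (simp add: mcomplete_of_def submetric_def Int_absorb2)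
qed

lemma supported_in_banach_subalgebra:
  assumes "clopen_sigma_cover X \<V>"
  shows "banach_subalgebra X (supported_in X \<V> :: ('a \<Rightarrow> 'k::{real_normed_field,complete_space}) set)"
  using supported_in_ideal[OF assms, where 'k='k] mcomplete_supported_in[OF assms, where 'k='k]
  unfolding banach_subalgebra_def ideal_of_Cb_def by blast

lemma Cc_subset_C0:
  "(Cc Y :: ('b \<Rightarrow> 'k::real_normed_field) set) \<subseteq> C0 Y"
proof
  fix g :: "'b \<Rightarrow> 'k" assume "g \<in> Cc Y"
  then have g: "g \<in> Cb Y" "compactin Y (Y closure_of {x\<in>topspace Y. g x \<noteq> 0})" by (auto simp: Cc_def)
  have "compactin Y {x\<in>topspace Y. \<epsilon> \<le> norm (g x)}" if "\<epsilon> > 0" for \<epsilon>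
  proof (rule closed_compactin[OF g(2)])
    have "{x\<in>topspace Y. g x \<noteq> 0} \<subseteq> Y closure_of {x\<in>topspace Y. g x \<noteq> 0}"
      by (rule closure_of_subset) auto
    then show "{x\<in>topspace Y. \<epsilon> \<le> norm (g x)} \<subseteq> Y closure_of {x\<in>topspace Y. g x \<noteq> 0}"
      using that by auto
    have "closed {z::'k. \<epsilon> \<le> norm z}" by (intro closed_Collect_le continuous_intros)
    then show "closedin Y {x\<in>topspace Y. \<epsilon> \<le> norm (g x)}"
      using closedin_continuous_map_preimage[OF Cb_continuous[OF g(1)], of "{z. \<epsilon> \<le> norm z}"] by simp
  qed
  then show "g \<in> C0 Y" using g(1) unfolding C0_def by blast
qed

section \<open>The locally compact space attached to a family of carriers, and its function
  algebra\<close>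

locale stone_cech_cover =
  fixes X :: "'a topology" and \<V> :: "'a set set" and B :: "'b topology" and e :: "'a \<Rightarrow> 'b"
    and k :: "'k::{real_normed_field,complete_space} itself"
  assumes nonempty: "topspace X \<noteq> {}"
    and cover: "clopen_sigma_cover X \<V>"
    and sc: "stone_cech X B e k"
begin

definition K where "K A = B closure_of (e ` A)"

definition Y where "Y = subtopology B (\<Union>(K ` \<V>))"

lemma compact_B: "compact_space B" and Hausdorff_B: "Hausdorff_space B"
  and continuous_e: "continuous_map X B e" and dense: "B closure_of (e ` topspace X) = topspace B"
  using sc unfolding stone_cech_def by blast+

lemma extension: "(f :: 'a \<Rightarrow> 'k) \<in> Cb X \<Longrightarrow> \<exists>g. continuous_map B euclidean g \<and> (\<forall>x\<in>topspace X. g (e x) = f x)"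
  using sc unfolding stone_cech_def by blast

lemma e_in_B: "x \<in> topspace X \<Longrightarrow> e x \<in> topspace B"
  using continuous_e continuous_map_image_subset_topspace by blast

lemma clopen: "A \<in> \<V> \<Longrightarrow> openin X A" "A \<in> \<V> \<Longrightarrow> closedin X A"
  using cover unfolding clopen_sigma_cover_def by blast+

lemma subset_X: "A \<in> \<V> \<Longrightarrow> A \<subseteq> topspace X"
  using clopen(1) openin_subset by blast

text \<open>The closures of the images of complementary clopen sets are separated by the extension of the
  indicator function.\<close>

lemma K_separated:
  assumes A: "A \<in> \<V>"
  shows "K A \<inter> K (topspace X - A) = {}" and "K A \<union> K (topspace X - A) = topspace B"
proof -
  obtain g :: "'b \<Rightarrow> 'k" where g: "continuous_map B euclidean g"
      "\<forall>x\<in>topspace X. g (e x) = clopen_indicator X A x"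
    using extension[OF clopen_indicator_Cb[OF clopen[OF A]]] by blast
  have 1: "g p = 1" if "p \<in> K A" for p
  proof (rule forall_in_closure_of_eq[OF that[unfolded K_def] _ g(1)])
    show "g q = 1" if "q \<in> e ` A" for q
      using that g(2) subset_X[OF A] by (auto simp: clopen_indicator_def)
  qed auto
  have 0: "g p = 0" if "p \<in> K (topspace X - A)" for p
  proof (rule forall_in_closure_of_eq[OF that[unfolded K_def] _ g(1)])
    show "g q = 0" if "q \<in> e ` (topspace X - A)" for q
      using that g(2) by (auto simp: clopen_indicator_def)
  qed auto
  show "K A \<inter> K (topspace X - A) = {}" using 0 1 by fastforce
  have "e ` A \<union> e ` (topspace X - A) = e ` topspace X" using subset_X[OF A] by blast
  then show "K A \<union> K (topspace X - A) = topspace B"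
    unfolding K_def closure_of_Un[symmetric] using dense by simp
qed

lemma closedin_K: "closedin B (K A)"
  unfolding K_def by simp

lemma openin_K:
  assumes "A \<in> \<V>"
  shows "openin B (K A)"
proof -
  have "K A = topspace B - K (topspace X - A)" using K_separated[OF assms] by blast
  then show ?thesis using closedin_K by auto
qed

lemma K_mono: "A \<subseteq> A' \<Longrightarrow> K A \<subseteq> K A'"
  unfolding K_def by (intro closure_of_mono image_mono)

text \<open>This stands in for injectivity of \<open>e\<close>: the images of a carrier and of its
  complement lie in disjoint closed sets, so vanishing off \<open>A\<close> and vanishing off
  \<open>K A\<close> correspond under composition with \<open>e\<close>.\<close>

lemma e_in_K_iff:
  assumes "A \<in> \<V>" "x \<in> topspace X"
  shows "e x \<in> K A \<longleftrightarrow> x \<in> A"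
proof -
  have sub: "e ` Z \<subseteq> K Z" if "Z \<subseteq> topspace X" for Z
    unfolding K_def using that e_in_B by (intro closure_of_subset) auto
  have "e ` A \<subseteq> K A" "e ` (topspace X - A) \<subseteq> K (topspace X - A)"
    using sub[OF subset_X[OF assms(1)]] sub[of "topspace X - A"] by auto
  then show ?thesis using K_separated(1)[OF assms(1)] assms(2) by blast
qed

lemma topspace_Y: "topspace Y = \<Union>(K ` \<V>)"
proof -
  have "\<Union>(K ` \<V>) \<subseteq> topspace B" using closedin_subset[OF closedin_K] by blast
  then show ?thesis unfolding Y_def topspace_subtopology by (rule Int_absorb1)
qed

lemma openin_Y: "openin B (topspace Y)"
  unfolding topspace_Y using openin_K by blast

lemma subtopology_Y: "subtopology B (topspace Y) = Y"
  unfolding topspace_Y by (rule Y_def[symmetric])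

lemma closure_of_Y: "Y closure_of S = topspace Y \<inter> B closure_of S"
proof -
  have "subtopology B (topspace Y) closure_of S = topspace Y \<inter> B closure_of S"
    by (intro closure_of_subtopology_open disjI1 openin_Y)
  then show ?thesis unfolding subtopology_Y .
qed

lemma e_in_Y:
  assumes "x \<in> topspace X"
  shows "e x \<in> topspace Y"
proof -
  obtain A where "A \<in> \<V>" "x \<in> A" using cover assms unfolding clopen_sigma_cover_def by blast
  then show ?thesis using e_in_K_iff assms unfolding topspace_Y by blast
qed

lemma continuous_e_Y: "continuous_map X Y e"
proof -
  have "continuous_map X (subtopology B (topspace Y)) e"
    unfolding continuous_map_in_subtopology using continuous_e e_in_Y by blast
  then show ?thesis unfolding subtopology_Y .
qed

lemma compactin_K: "A \<in> \<V> \<Longrightarrow> compactin Y (K A)"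
  unfolding Y_def compactin_subtopology
  using closedin_compact_space[OF compact_B closedin_K] by blast

lemma Y_nonempty: "topspace Y \<noteq> {}"
  using nonempty e_in_Y by blast

lemma Y_locally_compact: "locally_compact_Hausdorff Y"
  unfolding locally_compact_Hausdorff_def
proof
  have "locally_compact_space (subtopology B (topspace Y))"
    using openin_Y Hausdorff_B compact_imp_locally_compact_space[OF compact_B]
    by (intro locally_compact_space_open_subset) auto
  then show "locally_compact_space Y" unfolding subtopology_Y .
  show "Hausdorff_space Y" unfolding Y_def by (intro Hausdorff_space_subtopology Hausdorff_B)
qed

lemma Y_dense: "topspace Y \<subseteq> Y closure_of (e ` topspace X)"
  unfolding closure_of_Y dense using openin_subset[OF openin_Y] by blast

lemma eq_on_Y:
  fixes g h :: "'b \<Rightarrow> 'k"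
  assumes "continuous_map Y euclidean g" "continuous_map Y euclidean h"
    and "\<And>x. x \<in> topspace X \<Longrightarrow> g (e x) = h (e x)" and p: "p \<in> topspace Y"
  shows "g p = h p"
proof (rule forall_in_closure_of_eq[OF _ _ assms(1,2)])
  show "p \<in> Y closure_of (e ` topspace X)" using Y_dense p by blast
qed (use assms(3) in auto)

text \<open>The image of \<open>X\<close> is dense in \<open>Y\<close> and scalars are Hausdorff.
  Through this uniqueness principle each algebraic identity for \<open>T\<close> reduces to a
  pointwise identity on \<open>X\<close>.\<close>

lemma eq_Cb_Y:
  fixes g h :: "'b \<Rightarrow> 'k"
  assumes "g \<in> Cb Y" "h \<in> Cb Y" "\<And>x. x \<in> topspace X \<Longrightarrow> g (e x) = h (e x)"
  shows "g = h"
proof (rule extensionalityI)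
  show "g \<in> extensional (topspace Y)" "h \<in> extensional (topspace Y)"
    using assms Cb_extensional by blast+
  show "g p = h p" if "p \<in> topspace Y" for p
    using eq_on_Y[OF Cb_continuous Cb_continuous] assms that by blast
qed

text \<open>Here closure under countable unions yields \<open>C0 Y = Cc Y\<close>. Each level set is
  compact and is covered by the open sets \<open>K A\<close>, so finitely many suffice, and they fit
  into a single \<open>K (A n)\<close>. The closure belonging to the union of all \<open>A n\<close>
  is compact, lies in \<open>Y\<close> and contains every point where the function is
  non-zero.\<close>

lemma C0_vanishes_off_K:
  fixes g :: "'b \<Rightarrow> 'k"
  assumes "g \<in> C0 Y"
  obtains A where "A \<in> \<V>" "\<And>p. \<lbrakk>p \<in> topspace Y; p \<notin> K A\<rbrakk> \<Longrightarrow> g p = 0"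
proof -
  have "\<exists>A\<in>\<V>. {p\<in>topspace Y. inverse (real (Suc n)) \<le> norm (g p)} \<subseteq> K A" for n
  proof -
    let ?L = "{p\<in>topspace Y. inverse (real (Suc n)) \<le> norm (g p)}"
    have "compactin Y ?L" using assms unfolding C0_def by simp
    then have L: "compactin B ?L" unfolding Y_def compactin_subtopology by blast
    have "\<forall>U\<in>K ` \<V>. openin B U" "?L \<subseteq> \<Union>(K ` \<V>)" using openin_K topspace_Y by auto
    then obtain \<F> where F: "finite \<F>" "\<F> \<subseteq> K ` \<V>" "?L \<subseteq> \<Union>\<F>"
      using L[unfolded compactin_def, THEN conjunct2, rule_format, of "K ` \<V>"] by auto
    obtain \<A> where A: "finite \<A>" "\<A> \<subseteq> \<V>" "\<F> = K ` \<A>" using finite_subset_image[OF F(1,2)] by blast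
    have "\<Union>\<A> \<in> \<V>" using A(1,2) cover unfolding clopen_sigma_cover_def by (simp add: countable_finite)
    moreover have "\<Union>(K ` \<A>) \<subseteq> K (\<Union>\<A>)" by (intro UN_least K_mono) blast
    ultimately show ?thesis using F(3) A(3) by blast
  qed
  then obtain A where A: "\<And>n. A n \<in> \<V>" "\<And>n. {p\<in>topspace Y. inverse (real (Suc n)) \<le> norm (g p)} \<subseteq> K (A n)"
    by metis
  show thesis
  proof (rule that)
    show "(\<Union>n. A n) \<in> \<V>" using clopen_sigma_cover_UN[OF cover A(1)] .
    fix p assume p: "p \<in> topspace Y" "p \<notin> K (\<Union>n. A n)"
    show "g p = 0"
    proof (rule ccontr)
      assume "g p \<noteq> 0"
      then obtain n where "inverse (real (Suc n)) < norm (g p)"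
        using reals_Archimedean zero_less_norm_iff by blast
      then have "p \<in> K (A n)" using A(2)[of n] p(1) by auto
      moreover have "K (A n) \<subseteq> K (\<Union>n. A n)" by (intro K_mono) blast
      ultimately show False using p(2) by blast
    qed
  qed
qed

lemma CcI:
  fixes g :: "'b \<Rightarrow> 'k"
  assumes "g \<in> Cb Y" "A \<in> \<V>" "\<And>p. \<lbrakk>p \<in> topspace Y; p \<notin> K A\<rbrakk> \<Longrightarrow> g p = 0"
  shows "g \<in> Cc Y"
proof -
  have "closedin Y (K A)" 
    using Y_locally_compact compactin_imp_closedin[OF _ compactin_K[OF assms(2)]]
    unfolding locally_compact_Hausdorff_def by blast
  then have "Y closure_of {p\<in>topspace Y. g p \<noteq> 0} \<subseteq> K A"
    using assms(3) by (intro closure_of_minimal) auto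
  then have "compactin Y (Y closure_of {p\<in>topspace Y. g p \<noteq> 0})"
    by (intro closed_compactin[OF compactin_K[OF assms(2)]]) auto
  then show ?thesis using assms(1) unfolding Cc_def by blast
qed

lemma C0_eq_Cc: "(C0 Y :: ('b \<Rightarrow> 'k) set) = Cc Y"
proof
  show "(C0 Y :: ('b \<Rightarrow> 'k) set) \<subseteq> Cc Y"
  proof
    fix g :: "'b \<Rightarrow> 'k" assume g: "g \<in> C0 Y"
    then have "g \<in> Cb Y" unfolding C0_def by blast
    with C0_vanishes_off_K[OF g] CcI show "g \<in> Cc Y" by metis
  qed
qed (rule Cc_subset_C0)

text \<open>For bounded continuous \<open>f\<close> the chosen extension is unique on
  \<open>B\<close> by density, so the choice is immaterial. It is made on all of \<open>B\<close>,
  whose compactness bounds the extension, and then cut down to \<open>Y\<close>.\<close>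

definition T :: "('a \<Rightarrow> 'k) \<Rightarrow> 'b \<Rightarrow> 'k" where
  "T f = restrict (SOME g. continuous_map B euclidean g \<and> (\<forall>x\<in>topspace X. g (e x) = f x)) (topspace Y)"

lemma T:
  assumes "f \<in> Cb X"
  shows T_Cb: "T f \<in> Cb Y" and T_e: "\<And>x. x \<in> topspace X \<Longrightarrow> T f (e x) = f x"
proof -
  define g where "g = (SOME g. continuous_map B euclidean g \<and> (\<forall>x\<in>topspace X. g (e x) = f x))"
  have g: "continuous_map B euclidean g" "\<And>x. x \<in> topspace X \<Longrightarrow> g (e x) = f x"
    using someI_ex[OF extension[OF assms]] unfolding g_def by auto
  have Tg: "T f = restrict g (topspace Y)" unfolding T_def g_def ..
  show "T f (e x) = f x" if "x \<in> topspace X" for x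
    unfolding Tg using e_in_Y[OF that] g(2)[OF that] by simp
  have "compactin euclidean (g ` topspace B)"
    using image_compactin g(1) compact_B unfolding compact_space_def by blast
  then have "bounded (g ` topspace B)" using compact_imp_bounded by simp
  then obtain b where b: "\<And>p. p \<in> topspace B \<Longrightarrow> norm (g p) \<le> b" unfolding bounded_iff by blast
  show "T f \<in> Cb Y"
    unfolding Tg
  proof (rule Cb_restrictI)
    show "continuous_map Y euclidean g" unfolding Y_def by (rule continuous_map_from_subtopology[OF g(1)])
    show "norm (g p) \<le> b" if "p \<in> topspace Y" for p
      using b that openin_subset[OF openin_Y] by blast
  qed
qed

text \<open>A point outside \<open>K A\<close> lies in the closure of the image of the complement of
  \<open>A\<close>, because the two closures cover \<open>B\<close>. The extension is zero on that
  image, hence at the point.\<close>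

lemma T_C0:
  assumes "f \<in> supported_in X \<V>"
  shows "T f \<in> C0 Y"
proof -
  obtain A where A: "A \<in> \<V>" "\<And>x. \<lbrakk>x \<in> topspace X; x \<notin> A\<rbrakk> \<Longrightarrow> f x = 0" using supported_inE[OF assms] by metis
  have f: "f \<in> Cb X" using assms supported_in_Cb by blast
  have "T f p = 0" if p: "p \<in> topspace Y" "p \<notin> K A" for p
  proof (rule forall_in_closure_of_eq[OF _ _ Cb_continuous[OF T_Cb[OF f]]])
    have pB: "p \<in> B closure_of (e ` (topspace X - A))"
      using K_separated(2)[OF A(1)] p openin_subset[OF openin_Y] unfolding K_def by blast
    show "p \<in> Y closure_of (e ` (topspace X - A))"
      unfolding closure_of_Y using pB p(1) by blast
    show "T f q = 0" if "q \<in> e ` (topspace X - A)" for q using that T_e[OF f] A(2) by auto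
  qed auto
  then have "T f \<in> Cc Y" using CcI[OF T_Cb[OF f] A(1)] by blast
  then show ?thesis using C0_eq_Cc by simp
qed

lemma isometry: "isometrically_isomorphic X (supported_in X \<V> :: ('a \<Rightarrow> 'k) set) Y (C0 Y)"
  unfolding isometrically_isomorphic_def
proof (intro exI[of _ T] conjI ballI allI)
  have Cb: "f \<in> Cb X" if "f \<in> supported_in X \<V>" for f :: "'a \<Rightarrow> 'k" using that supported_in_Cb by blast
  show "bij_betw T (supported_in X \<V>) (C0 Y)"
    unfolding bij_betw_def
  proof
    show "inj_on T (supported_in X \<V>)"
    proof (rule inj_onI)
      fix f g :: "'a \<Rightarrow> 'k"
      assume fg: "f \<in> supported_in X \<V>" "g \<in> supported_in X \<V>" "T f = T g"
      show "f = g"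
      proof (rule extensionalityI)
        show "f \<in> extensional (topspace X)" "g \<in> extensional (topspace X)"
          using Cb fg Cb_extensional by blast+
        show "f x = g x" if "x \<in> topspace X" for x
          using T_e[OF Cb[OF fg(1)] that] T_e[OF Cb[OF fg(2)] that] fg(3) by simp
      qed
    qed
    show "T ` supported_in X \<V> = C0 Y"
    proof (intro subset_antisym subsetI)
      show "g \<in> C0 Y" if "g \<in> T ` supported_in X \<V>" for g using that T_C0 by blast
      fix g :: "'b \<Rightarrow> 'k" assume g: "g \<in> C0 Y"
      then have gCb: "g \<in> Cb Y" unfolding C0_def by blast
      obtain A where A: "A \<in> \<V>" "\<And>p. \<lbrakk>p \<in> topspace Y; p \<notin> K A\<rbrakk> \<Longrightarrow> g p = 0"
        using C0_vanishes_off_K[OF g] by metis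
      \<comment> \<open>The inverse of \<open>T\<close> is composition with \<open>e\<close>; a
        carrier of \<open>g\<close> in \<open>Y\<close> has the form \<open>K A\<close>, and
        \<open>A\<close> then carries the composition.\<close>
      define f where "f = (\<lambda>x\<in>topspace X. g (e x))"
      have fCb: "f \<in> Cb X"
        unfolding f_def
      proof (rule Cb_restrictI)
        show "continuous_map X euclidean (\<lambda>x. g (e x))"
          using continuous_map_compose[OF continuous_e_Y Cb_continuous[OF gCb]] by (simp add: o_def)
        show "norm (g (e x)) \<le> sup_norm Y g" if "x \<in> topspace X" for x
          using Cb_bound[OF gCb e_in_Y[OF that]] .
      qed
      have "f \<in> supported_in X \<V>"
      proof (rule supported_inI[OF fCb A(1)])
        show "f x = 0" if "x \<in> topspace X" "x \<notin> A" for x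
          using A(2)[OF e_in_Y[OF that(1)]] e_in_K_iff[OF A(1) that(1)] that unfolding f_def by simp
      qed
      moreover have "T f = g"
      proof (rule eq_Cb_Y[OF T_Cb[OF fCb] gCb])
        show "T f (e x) = g (e x)" if "x \<in> topspace X" for x
          unfolding T_e[OF fCb that] using that by (simp add: f_def)
      qed
      ultimately show "g \<in> T ` supported_in X \<V>" by blast
    qed
  qed
  fix f :: "'a \<Rightarrow> 'k" assume f: "f \<in> supported_in X \<V>"
  note Tf = T[OF Cb[OF f]]
  show "T (fun_scale X c f) = fun_scale Y c (T f)" for c
    using T[OF fun_scale_Cb[OF Cb[OF f], of c]] Tf e_in_Y
    by (intro eq_Cb_Y fun_scale_Cb) (simp_all add: fun_scale_def)
  show "sup_norm Y (T f) = sup_norm X f"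
  proof (rule antisym)
    show "sup_norm X f \<le> sup_norm Y (T f)"
      unfolding sup_norm_def[of X]
    proof (rule cSUP_least[OF nonempty])
      fix x assume x: "x \<in> topspace X"
      show "norm (f x) \<le> sup_norm Y (T f)"
        using Cb_bound[OF Tf(1) e_in_Y[OF x]] Tf(2)[OF x] by simp
    qed
    show "sup_norm Y (T f) \<le> sup_norm X f"
      unfolding sup_norm_def[of Y]
    proof (rule cSUP_least[OF Y_nonempty])
      fix p assume "p \<in> topspace Y"
      then have "p \<in> Y closure_of (e ` topspace X)" using Y_dense by blast
      \<comment> \<open>The bound is a closed condition on \<open>p\<close> and holds on a dense
        set.\<close>
      then show "norm (T f p) \<le> sup_norm X f"
      proof (rule forall_in_closure_of)
        show "norm (T f q) \<le> sup_norm X f" if "q \<in> e ` topspace X" for q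
          using that Tf(2) Cb_bound[OF Cb[OF f]] by auto
        have "closed {z::'k. norm z \<le> sup_norm X f}" by (intro closed_Collect_le continuous_intros)
        then show "closedin Y {p \<in> topspace Y. norm (T f p) \<le> sup_norm X f}"
          using closedin_continuous_map_preimage[OF Cb_continuous[OF Tf(1)], of "{z. norm z \<le> sup_norm X f}"]
          by simp
      qed
    qed
  qed
  fix g :: "'a \<Rightarrow> 'k" assume g: "g \<in> supported_in X \<V>"
  note Tg = T[OF Cb[OF g]]
  show "T (fun_add X f g) = fun_add Y (T f) (T g)"
    using T[OF fun_add_Cb[OF Cb[OF f] Cb[OF g]]] Tf Tg e_in_Y
    by (intro eq_Cb_Y fun_add_Cb) (simp_all add: fun_add_def)
  show "T (fun_mult X f g) = fun_mult Y (T f) (T g)"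
    using T[OF fun_mult_Cb[OF Cb[OF f] Cb[OF g]]] Tf Tg e_in_Y
    by (intro eq_Cb_Y fun_mult_Cb) (simp_all add: fun_mult_def)
qed

end

lemma supported_in_isometry:
  fixes X :: "'a topology"
  assumes "topspace X \<noteq> {}" "clopen_sigma_cover X \<V>"
  shows "\<exists>Y :: 'a set set topology. topspace Y \<noteq> {} \<and> locally_compact_Hausdorff Y \<and>
           (C0 Y :: ('a set set \<Rightarrow> 'k::{real_normed_field,heine_borel}) set) = Cc Y \<and>
           isometrically_isomorphic X (supported_in X \<V> :: ('a \<Rightarrow> 'k) set) Y (C0 Y)"
proof -
  obtain B :: "'a set set topology" and e where "stone_cech X B e TYPE('k)"
    using stone_cech_exists by blast
  then interpret stone_cech_cover X \<V> B e "TYPE('k)"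
    using assms by unfold_locales
  show ?thesis
    using Y_nonempty Y_locally_compact C0_eq_Cc isometry by (intro exI[of _ Y] conjI)
qed


section \<open>The chain of ideals\<close>

text \<open>A set of bounds instead of a single cardinal lets the empty set express that there is no
  bound, as is required at the top of the chain.\<close>

definition small_unions :: "'a set set \<Rightarrow> 'b rel set \<Rightarrow> 'a set set" where
  "small_unions P N = {\<Union>J | J. J \<subseteq> P \<and> (\<forall>n\<in>N. |J| \<le>o n)}"

lemma countable_ordLeq_Cinfinite:
  assumes "countable J" "Cinfinite n"
  shows "|J| \<le>o n"
  using assms countable_card_le_natLeq natLeq_ordLeq_cinfinite ordLeq_transitive by blast

text \<open>Countably many subfamilies of size at most an infinite \<open>n\<close> have a union of
  size at most \<open>n\<close>, so the bounds persist; singletons of members meet every bound, so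
  the carriers cover \<open>X\<close>.\<close>

lemma small_unions_sigma_cover:
  assumes P: "clopen_partition X P" and N: "\<And>n. n \<in> N \<Longrightarrow> Cinfinite n"
  shows "clopen_sigma_cover X (small_unions P N)"
  unfolding clopen_sigma_cover_def
proof (intro conjI ballI allI impI)
  fix A assume "A \<in> small_unions P N"
  then obtain J where J: "J \<subseteq> P" "A = \<Union>J" unfolding small_unions_def by blast
  show "openin X A" unfolding J(2) by (rule openin_Union_clopen_partition[OF P J(1)])
  show "closedin X A" unfolding J(2) by (rule closedin_Union_clopen_partition[OF P J(1)])
next
  fix \<A> assume A: "countable \<A> \<and> \<A> \<subseteq> small_unions P N"
  then have "\<exists>J. J \<subseteq> P \<and> (\<forall>n\<in>N. |J| \<le>o n) \<and> A = \<Union>J" if "A \<in> \<A>" for A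
    using that unfolding small_unions_def by blast
  then obtain J where J: "\<And>A. A \<in> \<A> \<Longrightarrow> J A \<subseteq> P \<and> (\<forall>n\<in>N. |J A| \<le>o n) \<and> A = \<Union>(J A)" by metis
  have "\<Union>\<A> = \<Union>(\<Union>(J ` \<A>))"
  proof (intro subset_antisym subsetI)
    fix x assume "x \<in> \<Union>\<A>"
    then obtain A where "A \<in> \<A>" "x \<in> A" by blast
    then show "x \<in> \<Union>(\<Union>(J ` \<A>))" using J[of A] by blast
  next
    fix x assume "x \<in> \<Union>(\<Union>(J ` \<A>))"
    then obtain A C where "A \<in> \<A>" "C \<in> J A" "x \<in> C" by blast
    then show "x \<in> \<Union>\<A>" using J[of A] by blast
  qed
  moreover have "\<Union>(J ` \<A>) \<subseteq> P" using J by blast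
  moreover have "|\<Union>(J ` \<A>)| \<le>o n" if "n \<in> N" for n
  proof (rule card_of_UNION_ordLeq_infinite_Field)
    show "infinite (Field n)" "Card_order n" using N[OF that] unfolding cinfinite_def by auto
    show "|\<A>| \<le>o n" using A N[OF that] by (intro countable_ordLeq_Cinfinite) auto
    show "\<forall>A\<in>\<A>. |J A| \<le>o n" using J that by blast
  qed
  ultimately show "\<Union>\<A> \<in> small_unions P N"
    unfolding small_unions_def by (intro CollectI exI conjI ballI)
next
  show "\<Union>(small_unions P N) = topspace X"
  proof (intro subset_antisym subsetI)
    fix x assume "x \<in> \<Union>(small_unions P N)"
    then show "x \<in> topspace X" using P unfolding small_unions_def clopen_partition_def by blast
  next
    fix x assume "x \<in> topspace X"
    then obtain C where C: "C \<in> P" "x \<in> C" using P unfolding clopen_partition_def by blast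
    have "|{C}| \<le>o n" if "n \<in> N" for n by (intro countable_ordLeq_Cinfinite N that) simp
    then have "\<Union>{C} \<in> small_unions P N" using C(1) unfolding small_unions_def by blast
    then show "x \<in> \<Union>(small_unions P N)" using C(2) by auto
  qed
qed

lemma clopen_indicator_supported:
  assumes "clopen_partition X P" "J \<subseteq> P" "\<And>n. n \<in> N \<Longrightarrow> |J| \<le>o n"
  shows "(clopen_indicator X (\<Union>J) :: 'a \<Rightarrow> 'k::real_normed_field) \<in> supported_in X (small_unions P N)"
proof (rule supported_inI)
  show "clopen_indicator X (\<Union>J) \<in> Cb X"
    using assms by (intro clopen_indicator_Cb openin_Union_clopen_partition closedin_Union_clopen_partition)
  show "\<Union>J \<in> small_unions P N" using assms(2,3) unfolding small_unions_def by blast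
qed (simp add: clopen_indicator_def)

text \<open>Any carrier of the indicator is a union of a small subfamily \<open>D\<close> and
  contains \<open>\<Union>J\<close>, whence \<open>J\<close> is part of \<open>D\<close>. Together
  with the preceding lemma this turns a strict inequality of cardinals into a strict inclusion of
  ideals.\<close>

lemma clopen_indicator_supportedD:
  assumes "clopen_partition X P" "J \<subseteq> P"
    and "(clopen_indicator X (\<Union>J) :: 'a \<Rightarrow> 'k::real_normed_field) \<in> supported_in X (small_unions P N)"
    and n: "n \<in> N"
  shows "|J| \<le>o n"
proof -
  obtain A where A: "A \<in> small_unions P N"
      "\<And>x. \<lbrakk>x \<in> topspace X; x \<notin> A\<rbrakk> \<Longrightarrow> (clopen_indicator X (\<Union>J) x :: 'k) = 0"
    using supported_inE[OF assms(3)] by metis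
  obtain D where D: "D \<subseteq> P" "|D| \<le>o n" "A = \<Union>D" using A(1) n unfolding small_unions_def by blast
  have "\<Union>J \<subseteq> \<Union>D"
  proof (rule subsetI, rule ccontr)
    fix x assume x: "x \<in> \<Union>J" "x \<notin> \<Union>D"
    then have "x \<in> topspace X" using assms(1,2) unfolding clopen_partition_def by blast
    then show False using A(2)[of x] x unfolding D(3) clopen_indicator_def by simp
  qed
  then have "J \<subseteq> D" by (rule partition_subset_of_Union[OF assms(1,2) D(1)])
  then show ?thesis using D(2) card_of_mono1 ordLeq_transitive by blast
qed

text \<open>A function in \<open>C0 X\<close> is at least \<open>1/n\<close> on a compact set only, which meets finitely many members of the
  partition; on the other hand the union of infinitely many members is not compact.\<close>

lemma C0_psubset_supported:
  assumes P: "clopen_partition X P" "infinite P" and N: "\<And>n. n \<in> N \<Longrightarrow> Cinfinite n"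
  shows "(C0 X :: ('a \<Rightarrow> 'k::real_normed_field) set) \<subset> supported_in X (small_unions P N)"
proof
  show "(C0 X :: ('a \<Rightarrow> 'k) set) \<subseteq> supported_in X (small_unions P N)"
  proof
    fix f :: "'a \<Rightarrow> 'k" assume f: "f \<in> C0 X"
    let ?K = "\<lambda>m. {x\<in>topspace X. inverse (real (Suc m)) \<le> norm (f x)}"
    have "\<exists>J. finite J \<and> J \<subseteq> P \<and> ?K m \<subseteq> \<Union>J" for m
    proof -
      have "compactin X (?K m)" using f unfolding C0_def by simp
      then show ?thesis by (rule clopen_partition_compactin[OF P(1)]) blast
    qed
    then obtain J where J: "\<And>m. finite (J m) \<and> J m \<subseteq> P \<and> ?K m \<subseteq> \<Union>(J m)" by metis
    have cnt: "countable (\<Union>m. J m)" using J by (intro countable_UN) (auto intro: countable_finite)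
    show "f \<in> supported_in X (small_unions P N)"
    proof (rule supported_inI)
      show "f \<in> Cb X" using f unfolding C0_def by blast
      have "(\<Union>m. J m) \<subseteq> P" using J by blast
      moreover have "|\<Union>m. J m| \<le>o n" if "n \<in> N" for n using countable_ordLeq_Cinfinite[OF cnt N[OF that]] .
      ultimately show "\<Union>(\<Union>m. J m) \<in> small_unions P N" unfolding small_unions_def by blast
      fix x assume x: "x \<in> topspace X" "x \<notin> \<Union>(\<Union>m. J m)"
      show "f x = 0"
      proof (rule ccontr)
        assume "f x \<noteq> 0"
        then obtain m where "inverse (real (Suc m)) < norm (f x)"
          using reals_Archimedean zero_less_norm_iff by blast
        then have "x \<in> ?K m" using x(1) by simp
        then have "x \<in> \<Union>(J m)" using J by blast
        then show False using x(2) by blast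
      qed
    qed
  qed
  \<comment> \<open>Countability puts \<open>J\<close> below every infinite bound in
    \<open>N\<close>, while infinitude keeps \<open>\<Union>J\<close> from being compact.\<close>
  obtain J where J: "countable J" "infinite J" "J \<subseteq> P"
    using infinite_countable_subset'[OF P(2)] by blast
  let ?g = "clopen_indicator X (\<Union>J) :: 'a \<Rightarrow> 'k"
  have "?g \<in> supported_in X (small_unions P N)"
    by (intro clopen_indicator_supported[OF P(1) J(3)] countable_ordLeq_Cinfinite[OF J(1)] N)
  moreover have "?g \<notin> C0 X"
  proof
    assume "?g \<in> C0 X"
    then have "compactin X {x\<in>topspace X. 1 \<le> norm (?g x)}" unfolding C0_def by (simp del: One_nat_def)
    moreover have "{x\<in>topspace X. 1 \<le> norm (?g x)} = \<Union>J"
    proof -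
      have "\<Union>J \<subseteq> topspace X" using P(1) J(3) unfolding clopen_partition_def by blast
      then show ?thesis unfolding clopen_indicator_def by auto
    qed
    ultimately have "compactin X (\<Union>J)" by simp
    then obtain D where D: "finite D" "D \<subseteq> P" "\<Union>J \<subseteq> \<Union>D"
      using clopen_partition_compactin[OF P(1)] by blast
    then have "J \<subseteq> D" using partition_subset_of_Union[OF P(1) J(3)] by blast
    then show False using D(1) J(2) finite_subset by blast
  qed
  ultimately show "(C0 X :: ('a \<Rightarrow> 'k) set) \<noteq> supported_in X (small_unions P N)" by blast
qed

section \<open>Ordinals below \<open>L\<close> as initial segments, and the chain indexed by
  them\<close>

lemma Restr_underS_ordLess:
  assumes L: "Well_order L" and ij: "i \<in> underS L j"
  shows "Restr L (underS L i) <o Restr L (underS L j)"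
proof -
  have wo: "wo_rel L" using L by (simp add: wo_rel_def)
  have "underS L i \<subset> underS L j"
    using ij wo_rel.ANTISYM[OF wo] wo_rel.TRANS[OF wo]
    unfolding underS_def antisym_def trans_def by blast
  then show ?thesis
    using ofilter_subset_ordLess[OF L wo_rel.underS_ofilter[OF wo] wo_rel.underS_ofilter[OF wo]] by blast
qed

lemma underS_cases:
  assumes "Well_order L" "i \<in> Field L" "j \<in> Field L"
  obtains "i = j" | "i \<in> underS L j" | "j \<in> underS L i"
proof -
  have "wo_rel L" using assms(1) by (simp add: wo_rel_def)
  then have "(i, j) \<in> L \<or> (j, i) \<in> L" using wo_rel.TOTALS assms(2,3) by metis
  then show ?thesis using that unfolding underS_def by blast
qed

text \<open>The topology enters only through an infinite clopen partition at least as large as the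
  given aleph. The scalars are left general so that the real and the complex chain are two
  instances.\<close>

lemma aleph_chain:
  fixes X :: "'a topology" and L :: "'i rel" and k :: "'b rel"
  assumes "topspace X \<noteq> {}" and P: "clopen_partition X P" "infinite P"
    and aleph: "is_aleph L k" and kP: "k \<le>o |P|"
  shows "\<exists>H :: 'i rel \<Rightarrow> ('a \<Rightarrow> 'k::{real_normed_field,heine_borel}) set.
        C0 X \<subset> H {} \<and> H L = Cb X \<and>
        (\<forall>\<mu> \<kappa>. \<mu> =o \<kappa> \<and> \<kappa> \<le>o L \<longrightarrow> H \<mu> = H \<kappa>) \<and>
        (\<forall>\<mu> \<kappa>. \<mu> <o \<kappa> \<and> \<kappa> \<le>o L \<longrightarrow> H \<mu> \<subset> H \<kappa>) \<and>
        (\<forall>\<mu>. \<mu> \<le>o L \<longrightarrow>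
           banach_subalgebra X (H \<mu>) \<and> ideal_of_Cb X (H \<mu>) \<and>
           (\<exists>Y :: 'a set set topology.
              topspace Y \<noteq> {} \<and> locally_compact_Hausdorff Y \<and>
              (C0 Y :: ('a set set \<Rightarrow> 'k) set) = Cc Y \<and>
              isometrically_isomorphic X (H \<mu>) Y (C0 Y)))"
proof -
  have L: "Well_order L" using aleph unfolding is_aleph_def by blast
  obtain F :: "'i \<Rightarrow> 'b rel" where
    F: "\<And>i. i \<in> Field L \<Longrightarrow> least_infinite_card_above (F ` underS L i) (F i)"
    and Fk: "least_infinite_card_above (F ` Field L) k"
    using aleph unfolding is_aleph_def by blast
  have F_inf: "Cinfinite (F i)" if "i \<in> Field L" for i
    using F[OF that] unfolding least_infinite_card_above_def by blast
  have F_less: "F i <o F j" if "i \<in> underS L j" "j \<in> Field L" for i j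
    using F[OF that(2)] that(1) unfolding least_infinite_card_above_def by blast
  have F_P: "F i <o |P|" if "i \<in> Field L" for i
  proof -
    have "F i <o k" using Fk that unfolding least_infinite_card_above_def by blast
    then show ?thesis using kP ordLess_ordLeq_trans by blast
  qed
  \<comment> \<open>The segment below \<open>i\<close> represents the ordinal whose aleph is
    \<open>F i\<close>; up to isomorphism these segments are exactly the ordinals below
    \<open>L\<close>.\<close>
  define seg where "seg i = Restr L (underS L i)" for i
  have seg_less: "seg i <o seg j" if "i \<in> underS L j" for i j
    unfolding seg_def using Restr_underS_ordLess[OF L that] .
  have seg_lessD: "i \<in> underS L j" if "i \<in> Field L" "j \<in> Field L" "seg i <o seg j" for i j
    using underS_cases[OF L that(1,2)]
  proof cases
    case 1 then show ?thesis using that(3) ordLess_irreflexive by blast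
  next
    case 3 then show ?thesis using that(3) seg_less ordLess_transitive ordLess_irreflexive by blast
  qed
  have seg_inj: "i = j" if "i \<in> Field L" "j \<in> Field L" "seg i =o seg j" for i j
    using underS_cases[OF L that(1,2)]
  proof cases
    case 2 then show ?thesis using that(3) seg_less not_ordLess_ordIso by blast
  next
    case 3 then show ?thesis using that(3) seg_less not_ordLess_ordIso ordIso_symmetric by blast
  qed
  have less_L: "(\<exists>i\<in>Field L. \<mu> =o seg i) \<longleftrightarrow> \<mu> <o L" if "Well_order \<mu>" for \<mu> :: "'i rel"
    unfolding seg_def using ordLess_iff_ordIso_Restr[OF L that] by simp

  \<comment> \<open>For an ordinal below \<open>L\<close> this is the singleton of its aleph; for
    one isomorphic to \<open>L\<close> it is empty, as no well-order is isomorphic to a proper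
    initial segment of itself. Collecting all suitable \<open>i\<close> avoids a choice and makes
    \<open>H\<close> depend on the order type alone.\<close>
  define N where "N \<mu> = {F i | i. i \<in> Field L \<and> \<mu> =o seg i}" for \<mu> :: "'i rel"
  define H where "H \<mu> = (supported_in X (small_unions P (N \<mu>)) :: ('a \<Rightarrow> 'k) set)" for \<mu>
  have N_inf: "Cinfinite n" if "n \<in> N \<mu>" for n \<mu> using that F_inf unfolding N_def by blast
  have N_cong: "N \<mu> = N \<kappa>" if "\<mu> =o \<kappa>" for \<mu> \<kappa>
    using that ordIso_symmetric ordIso_transitive unfolding N_def by blast
  have N_L: "N \<kappa> = {}" if "\<kappa> =o L" for \<kappa>
  proof -
    have "\<not> L <o L" using ordLess_irreflexive by blast
    then have "N L = {}" using less_L[OF L] unfolding N_def by blast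
    then show ?thesis using N_cong[OF that] by simp
  qed
  have H_L: "H L = Cb X"
  proof
    show "H L \<subseteq> Cb X" unfolding H_def by (rule supported_in_Cb)
    have "\<Union>P \<in> small_unions P (N L)"
      using N_L[OF ordIso_reflexive[OF L]] unfolding small_unions_def by blast
    then have "topspace X \<in> small_unions P (N L)" using P(1) unfolding clopen_partition_def by simp
    then show "Cb X \<subseteq> H L" unfolding H_def by (auto intro: supported_inI)
  qed
  have H_less: "H \<mu> \<subset> H \<kappa>" if less: "\<mu> <o \<kappa>" and le: "\<kappa> \<le>o L" for \<mu> \<kappa>
  proof -
    have wo: "Well_order \<mu>" "Well_order \<kappa>" using less unfolding ordLess_def by auto
    have "\<mu> <o L" using ordLess_ordLeq_trans[OF less le] .
    then obtain i where i: "i \<in> Field L" "\<mu> =o seg i" using less_L[OF wo(1)] by blast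
    have Ni: "F i \<in> N \<mu>" using i unfolding N_def by blast
    have N_less: "F i <o F j" if j: "j \<in> Field L" "\<kappa> =o seg j" for j
    proof -
      have "seg i <o \<kappa>" using less i(2) ordIso_symmetric ordIso_ordLess_trans by blast
      then have "seg i <o seg j" using j(2) ordLess_ordIso_trans by blast
      then show ?thesis using F_less seg_lessD i(1) j(1) by blast
    qed
    \<comment> \<open>The witness for strictness: below the top, a subfamily whose size is exactly
      the aleph of \<kappa>, which exists as that aleph is less than \<open>|P|\<close>; at the top,
      \<open>P\<close> itself.\<close>
    have "\<exists>J\<subseteq>P. (\<forall>n\<in>N \<kappa>. |J| \<le>o n) \<and> F i <o |J|"
    proof (cases "\<kappa> <o L")
      case True
      then obtain j where j: "j \<in> Field L" "\<kappa> =o seg j" using less_L[OF wo(2)] by blast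
      have "|Field (F j)| =o F j" using F_inf[OF j(1)] card_of_Field_ordIso by blast
      moreover have "F j \<le>o |P|" using F_P[OF j(1)] ordLess_imp_ordLeq by blast
      ultimately have "|Field (F j)| \<le>o |P|" using ordIso_ordLeq_trans by blast
      then obtain J where J: "J \<subseteq> P" "|Field (F j)| =o |J|"
        using internalize_card_of_ordLeq2 by metis
      have FJ: "F j =o |J|"
        using \<open>|Field (F j)| =o F j\<close> J(2) ordIso_symmetric ordIso_transitive by blast
      have "|J| \<le>o n" if n: "n \<in> N \<kappa>" for n
      proof -
        obtain j' where j': "j' \<in> Field L" "\<kappa> =o seg j'" "n = F j'" using n unfolding N_def by blast
        have "j' = j" using seg_inj j j' ordIso_symmetric ordIso_transitive by blast
        then show ?thesis using FJ j'(3) ordIso_symmetric ordIso_imp_ordLeq by blast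
      qed
      moreover have "F i <o |J|" using N_less[OF j] FJ ordLess_ordIso_trans by blast
      ultimately show ?thesis using J(1) by blast
    next
      case False
      then have "\<kappa> =o L" using le ordLeq_iff_ordLess_or_ordIso by blast
      then have "N \<kappa> = {}" by (rule N_L)
      then show ?thesis using F_P[OF i(1)] by blast
    qed
    then obtain J where J: "J \<subseteq> P" "\<And>n. n \<in> N \<kappa> \<Longrightarrow> |J| \<le>o n" "F i <o |J|" by blast
    let ?g = "clopen_indicator X (\<Union>J) :: 'a \<Rightarrow> 'k"
    have "?g \<in> H \<kappa>" unfolding H_def using clopen_indicator_supported[OF P(1) J(1,2)] .
    moreover have "?g \<notin> H \<mu>"
    proof
      assume "?g \<in> H \<mu>"
      then have "|J| \<le>o F i"
        unfolding H_def using clopen_indicator_supportedD[OF P(1) J(1) _ Ni] by blast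
      then show False using J(3) not_ordLess_ordLeq by blast
    qed
    moreover have "small_unions P (N \<mu>) \<subseteq> small_unions P (N \<kappa>)"
    proof
      fix A assume "A \<in> small_unions P (N \<mu>)"
      then obtain D where D: "D \<subseteq> P" "|D| \<le>o F i" "A = \<Union>D" using Ni unfolding small_unions_def by blast
      have "|D| \<le>o n" if "n \<in> N \<kappa>" for n
      proof -
        have "F i <o n" using that N_less unfolding N_def by blast
        then show ?thesis using D(2) ordLess_imp_ordLeq ordLeq_transitive by blast
      qed
      then show "A \<in> small_unions P (N \<kappa>)" using D(1,3) unfolding small_unions_def by blast
    qed
    then have "H \<mu> \<subseteq> H \<kappa>" unfolding H_def supported_in_def by blast
    ultimately show ?thesis by blast
  qed
  have cover: "clopen_sigma_cover X (small_unions P (N \<mu>))" for \<mu>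
    using small_unions_sigma_cover[OF P(1) N_inf] .
  show ?thesis
  proof (intro exI[of _ H] conjI allI impI)
    \<comment> \<open>The empty relation is the ordinal 0. The inclusion is strict because every
      cardinal in \<open>N {}\<close> is infinite.\<close>
    show "C0 X \<subset> H {}" unfolding H_def using C0_psubset_supported[OF P N_inf] .
    show "H L = Cb X" by (rule H_L)
    show "H \<mu> = H \<kappa>" if "\<mu> =o \<kappa> \<and> \<kappa> \<le>o L" for \<mu> \<kappa>
      unfolding H_def using N_cong[OF conjunct1[OF that]] by simp
    show "H \<mu> \<subset> H \<kappa>" if "\<mu> <o \<kappa> \<and> \<kappa> \<le>o L" for \<mu> \<kappa>
      using H_less[OF conjunct1[OF that] conjunct2[OF that]] .
    show "banach_subalgebra X (H \<mu>)" for \<mu> unfolding H_def by (rule supported_in_banach_subalgebra[OF cover])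
    show "ideal_of_Cb X (H \<mu>)" for \<mu> unfolding H_def by (rule supported_in_ideal[OF cover])
    show "\<exists>Y :: 'a set set topology. topspace Y \<noteq> {} \<and> locally_compact_Hausdorff Y \<and>
         (C0 Y :: ('a set set \<Rightarrow> 'k) set) = Cc Y \<and> isometrically_isomorphic X (H \<mu>) Y (C0 Y)" for \<mu>
      unfolding H_def by (rule supported_in_isometry[OF assms(1) cover])
  qed
qed

lemma lindelof_clopen_partition_exists:
  assumes "locally_compact_Hausdorff X \<and> paracompact_Hausdorff X \<or> locally_lindelof X \<and> metrizable_space X"
  shows "\<exists>P. clopen_partition X P \<and> (\<forall>C\<in>P. Lindelof_space (subtopology X C))"
  using assms paracompact_clopen_partition metrizable_clopen_partition
  unfolding locally_compact_Hausdorff_def by blast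

text \<open>Since \<open>lindelof\<close> includes regularity and the Hausdorff property, its
  negation might come from a failure of separation. Either hypothesis on \<open>X\<close> excludes
  this, so the covering property itself fails.\<close>

lemma not_lindelof_imp_not_Lindelof_space:
  assumes "locally_compact_Hausdorff X \<and> paracompact_Hausdorff X \<or> locally_lindelof X \<and> metrizable_space X"
    and "\<not> lindelof X"
  shows "\<not> Lindelof_space X"
proof -
  have "regular_space X \<and> Hausdorff_space X"
    using assms(1)
  proof
    assume "locally_compact_Hausdorff X \<and> paracompact_Hausdorff X"
    then show ?thesis
      using locally_compact_Hausdorff_imp_regular_space unfolding locally_compact_Hausdorff_def by blast
  next
    assume "locally_lindelof X \<and> metrizable_space X"
    then show ?thesis using metrizable_imp_regular_space metrizable_imp_Hausdorff_space by blast
  qed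
  then show ?thesis using assms(2) unfolding lindelof_def by blast
qed

theorem theorem4p11:
  fixes X :: "'a topology" and L :: "'i rel"
  assumes "topspace X \<noteq> {}"
    and "\<not> lindelof X"
    and "locally_compact_Hausdorff X \<and> paracompact_Hausdorff X \<or>
         locally_lindelof X \<and> metrizable_space X"
    and "is_aleph L (lindelof_number X)"
  shows
    "(\<exists>H :: 'i rel \<Rightarrow> ('a \<Rightarrow> real) set.
        C0 X \<subset> H {} \<and> H L = Cb X \<and>
        (\<forall>\<mu> \<kappa>. \<mu> =o \<kappa> \<and> \<kappa> \<le>o L \<longrightarrow> H \<mu> = H \<kappa>) \<and>
        (\<forall>\<mu> \<kappa>. \<mu> <o \<kappa> \<and> \<kappa> \<le>o L \<longrightarrow> H \<mu> \<subset> H \<kappa>) \<and>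
        (\<forall>\<mu>. \<mu> \<le>o L \<longrightarrow>
           banach_subalgebra X (H \<mu>) \<and> ideal_of_Cb X (H \<mu>) \<and>
           (\<exists>Y :: 'a set set topology.
              topspace Y \<noteq> {} \<and> locally_compact_Hausdorff Y \<and>
              (C0 Y :: ('a set set \<Rightarrow> real) set) = Cc Y \<and>
              isometrically_isomorphic X (H \<mu>) Y (C0 Y)))) \<and>
     (\<exists>H :: 'i rel \<Rightarrow> ('a \<Rightarrow> complex) set.
        C0 X \<subset> H {} \<and> H L = Cb X \<and>
        (\<forall>\<mu> \<kappa>. \<mu> =o \<kappa> \<and> \<kappa> \<le>o L \<longrightarrow> H \<mu> = H \<kappa>) \<and>
        (\<forall>\<mu> \<kappa>. \<mu> <o \<kappa> \<and> \<kappa> \<le>o L \<longrightarrow> H \<mu> \<subset> H \<kappa>) \<and>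
        (\<forall>\<mu>. \<mu> \<le>o L \<longrightarrow>
           banach_subalgebra X (H \<mu>) \<and> ideal_of_Cb X (H \<mu>) \<and>
           (\<exists>Y :: 'a set set topology.
              topspace Y \<noteq> {} \<and> locally_compact_Hausdorff Y \<and>
              (C0 Y :: ('a set set \<Rightarrow> complex) set) = Cc Y \<and>
              isometrically_isomorphic X (H \<mu>) Y (C0 Y))))"
proof -
  obtain P where P: "clopen_partition X P" "\<And>C. C \<in> P \<Longrightarrow> Lindelof_space (subtopology X C)"
    using lindelof_clopen_partition_exists[OF assms(3)] by blast
  note size = lindelof_number_le_partition[OF P not_lindelof_imp_not_Lindelof_space[OF assms(3,2)]]
  show ?thesis
    by (rule conjI; rule aleph_chain[OF assms(1) P(1) size(1) assms(4) size(2)])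
qed

end
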